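(* Let $s \in \mathbb{N}$ and let $q$ be a prime number. There exists a constant $c(q,s)>0$, depending only on $q$ and $s$, such that for $\mu_s$-almost all $s$-tuples $(C_1,\ldots,C_s) \in (\mathbb{Z}_q^{\mathbb{N} \times \mathbb{N}})^s$ of generating matrices the digital sequence $\mathcal{S}(C_1,\ldots,C_s)$ over $\mathbb{Z}_q$ has star discrepancy satisfying $$D_N^\ast(\mathcal{S}(C_1,\ldots,C_s)) \ge c(q,s)\, (\log N)^s \log \log N \quad \text{for infinitely many } N \in \mathbb{N}.$$
   Context: $\mathbb{N}$ is the set of positive integers and $\mathbb{N}_0=\mathbb{N}\cup\{0\}$. For a prime $q$, $\mathbb{Z}_q=\{0,1,\ldots,q-1\}$ with arithmetic modulo $q$ (the field with $q$ elements). Digital sequence: given $C_1,\ldots,C_s \in \mathbb{Z}_q^{\mathbb{N}\times\mathbb{N}}$ and $n\in\mathbb{N}_0$ with (finite) $q$-adic expansion $n=n_0+n_1q+n_2q^2+\cdots$, put $\vec{n}=(n_0,n_1,n_2,\ldots)^\top$ and $C_j\vec{n}=(x_{n,j,1},x_{n,j,2},\ldots)^\top$ (computed modulo $q$; the sums are finite), $x_{n,j}=\sum_{i\ge 1}x_{n,j,i}q^{-i}$, and $\boldsymbol{x}_n=(x_{n,1},\ldots,x_{n,s})$. The sequence $(\boldsymbol{x}_n)_{n\ge 0}$ is the digital sequence $\mathcal{S}(C_1,\ldots,C_s)$ over $\mathbb{Z}_q$. Star discrepancy (not normalized by $N$): for a sequence $\mathcal{S}=(\boldsymbol{x}_n)_{n\ge0}$,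 $\boldsymbol{x}=(x_1,\ldots,x_s)\in[0,1]^s$ and $N\in\mathbb{N}$ let $$D(\boldsymbol{x},N)=\#\Big\{0\le n<N : \boldsymbol{x}_n\in\prod_{j=1}^s[0,x_j)\Big\}-N x_1\cdots x_s,$$ and $D_N^\ast(\mathcal{S})=\sup_{\boldsymbol{x}\in[0,1]^s}|D(\boldsymbol{x},N)|$. Measure: $\widetilde{\mu}$ is the product probability measure on $\mathbb{Z}_q^{\mathbb{N}}$ induced by the uniform probability measure on $\mathbb{Z}_q$; $\mu$ is the product measure on $\mathbb{Z}_q^{\mathbb{N}\times\mathbb{N}}$, viewed as a product of countably many copies of $(\mathbb{Z}_q^{\mathbb{N}},\widetilde{\mu})$; $\mu_s$ is the $s$-fold product measure of $\mu$ on $(\mathbb{Z}_q^{\mathbb{N}\times\mathbb{N}})^s$. (So under $\mu_s$ all matrix entries are independent and uniform on $\mathbb{Z}_q$.) *)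

theory Defs
  imports "HOL-Probability.Probability" "HOL-Computational_Algebra.Primes"
begin

(* Elements of Z_q are the natural numbers below q.  All index sets are 0-based: matrix rows
   and columns and the positions of q-adic digits range over nat, coordinates over {..<s}.
   A tuple of matrices is C :: nat => nat => nat => nat, with C j i r the entry in row i and
   column r of the j-th matrix; rows are the outer index, so C j i is a point of Z_q^nat. *)

definition row_measure :: "nat \<Rightarrow> (nat \<Rightarrow> nat) measure" where
  "row_measure q = (\<Pi>\<^sub>M r\<in>UNIV. uniform_count_measure {..<q})"

definition matrix_measure :: "nat \<Rightarrow> (nat \<Rightarrow> nat \<Rightarrow> nat) measure" where
  "matrix_measure q = (\<Pi>\<^sub>M i\<in>UNIV. row_measure q)"

definition matrix_tuple_measure :: "nat \<Rightarrow> nat \<Rightarrow> (nat \<Rightarrow> nat \<Rightarrow> nat \<Rightarrow> nat) measure" where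
  "matrix_tuple_measure q s = (\<Pi>\<^sub>M j\<in>{..<s}. matrix_measure q)"

definition qadic_digit :: "nat \<Rightarrow> nat \<Rightarrow> nat \<Rightarrow> nat" where
  "qadic_digit q n r = n div q ^ r mod q"

(* Summing over the support of the digit expansion, which is finite for q >= 2, gives the
   product of an infinite matrix with the digit vector of n. *)
definition output_digit :: "nat \<Rightarrow> (nat \<Rightarrow> nat \<Rightarrow> nat) \<Rightarrow> nat \<Rightarrow> nat \<Rightarrow> nat" where
  "output_digit q A n i = (\<Sum>r | qadic_digit q n r \<noteq> 0. A i r * qadic_digit q n r) mod q"

(* Because rows are numbered from 0, row i carries the weight q^-(i+1). *)
definition digital_sequence :: "nat \<Rightarrow> (nat \<Rightarrow> nat \<Rightarrow> nat \<Rightarrow> nat) \<Rightarrow> nat \<Rightarrow> nat \<Rightarrow> real" where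
  "digital_sequence q C n j = (\<Sum>i. real (output_digit q (C j) n i) / real q ^ Suc i)"

(* A sequence X in R^s has X n j as the j-th coordinate of its n-th point; only the
   coordinates j < s are relevant. *)
definition discrepancy_function ::
    "nat \<Rightarrow> (nat \<Rightarrow> nat \<Rightarrow> real) \<Rightarrow> (nat \<Rightarrow> real) \<Rightarrow> nat \<Rightarrow> real" where
  "discrepancy_function s X x N =
     real (card {n. n < N \<and> (\<forall>j<s. X n j \<in> {0..<x j})}) - real N * (\<Prod>j<s. x j)"

(* The supremum is over a nonempty set bounded above by N, so the conditionally complete
   SUP on the reals is the true supremum. *)
definition star_discrepancy :: "nat \<Rightarrow> (nat \<Rightarrow> nat \<Rightarrow> real) \<Rightarrow> nat \<Rightarrow> real" where
  "star_discrepancy s X N =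
     (SUP x \<in> {..<s} \<rightarrow>\<^sub>E {0..1}. \<bar>discrepancy_function s X x N\<bar>)"

end

(* For a finitely supported integer vector k on the positions (j, i), consider the linear form
   sum k(j,i) * (row i of C_j).  If its first L entries vanish modulo q, then the output digits of the
   first N = q^L points all satisfy one linear equation over Z_q.  If k lives on the first d_j rows of
   the j-th matrix, some box of volume about q^-(d_0 + ... + d_(s-1)) contains none of these points, so
   the discrepancy is at least of order q^(L - sum d_j).  The vanishing events have probability q^-L
   and are pairwise independent for linearly independent k.  There are about m^(s-1) q^(sm) vectors
   with sum d_j = s m; taking q^(L - sm) of order m^s ln m makes the sum of the probabilities
   diverge like sum 1 / (m ln m), so by the second Borel-Cantelli lemma almost surely infinitely many of the
   events occur, and m is of order ln N. *)

theory Submission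
  imports Defs
begin

section \<open>Pairwise independent events\<close>

text \<open>Forms that vanish on a column make their linear combinations vanish as well, and such
  combinations occur in the family again. The events are therefore not mutually independent, and a
  second-moment bound takes the place of the usual product argument. Every vector is normalized to
  have coefficient 1 at its last place in each coordinate. In coordinate 0 this excludes
  proportional vectors, so that different ones are independent modulo q, and it makes the digit
  pattern with a single 1 at that place violate the equation. In all coordinates together it lets
  the degrees be read off from the vector. The price is a constant factor q^-s in the count. The
  star discrepancy tests only boxes anchored at 0, and each such box with positive sides contains
  the zeroth point, which is 0. The empty box must stay away from the origin, so it is realized as
  the difference of two anchored boxes, one of which then has large discrepancy.\<close>

context prob_space
begin

text \<open>Chebyshev's argument. Pairwise independence removes the covariances, so the number
  \<open>Z\<close> of occurring events has variance at most its mean \<open>\<mu>\<close>; where no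
  event occurs, \<open>(Z x - \<mu>)\<^sup>2\<close> equals \<open>\<mu>\<^sup>2\<close>.\<close>

lemma prob_avoid_all_le:
  assumes fin: "finite G" and ev: "\<And>k. k \<in> G \<Longrightarrow> A k \<in> events"
    and indep: "\<And>k l. k \<in> G \<Longrightarrow> l \<in> G \<Longrightarrow> k \<noteq> l \<Longrightarrow> prob (A k \<inter> A l) = prob (A k) * prob (A l)"
    and pos: "(\<Sum>k\<in>G. prob (A k)) > 0"
  shows "prob {x \<in> space M. \<forall>k\<in>G. x \<notin> A k} \<le> 1 / (\<Sum>k\<in>G. prob (A k))"
proof -
  define \<mu> where "\<mu> = (\<Sum>k\<in>G. prob (A k))"
  define Z where "Z x = (\<Sum>k\<in>G. indicat_real (A k) x)" for x
  let ?V = "{x \<in> space M. \<forall>k\<in>G. x \<notin> A k}"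
  have V: "?V \<in> events" using fin ev by measurable
  have int1: "integrable M (indicat_real (A k))" if "k \<in> G" for k
    using ev[OF that] by (simp add: integrable_real_indicator emeasure_eq_measure)
  have int2: "integrable M (indicat_real (A k \<inter> A l))" if "k \<in> G" "l \<in> G" for k l
    using ev that by (intro integrable_real_indicator) (auto simp: emeasure_eq_measure)
  have sq: "(Z x - \<mu>)\<^sup>2 = (\<Sum>k\<in>G. \<Sum>l\<in>G. indicat_real (A k \<inter> A l) x)
      - 2 * \<mu> * (\<Sum>k\<in>G. indicat_real (A k) x) + \<mu>\<^sup>2" for x
  proof -
    have "(Z x)\<^sup>2 = (\<Sum>k\<in>G. \<Sum>l\<in>G. indicat_real (A k \<inter> A l) x)"
      unfolding Z_def power2_eq_square sum_product by (simp add: indicator_inter_arith)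
    then show ?thesis by (simp add: power2_diff Z_def)
  qed
  have intsq: "integrable M (\<lambda>x. (Z x - \<mu>)\<^sup>2)"
    unfolding sq by (intro Bochner_Integration.integrable_add Bochner_Integration.integrable_diff
      Bochner_Integration.integrable_sum integrable_mult_right int1 int2 integrable_const) auto
  have E2: "(\<integral>x. (\<Sum>k\<in>G. \<Sum>l\<in>G. indicat_real (A k \<inter> A l) x) \<partial>M) = (\<Sum>k\<in>G. \<Sum>l\<in>G. prob (A k \<inter> A l))"
  proof -
    have "(\<integral>x. (\<Sum>k\<in>G. \<Sum>l\<in>G. indicat_real (A k \<inter> A l) x) \<partial>M)
        = (\<Sum>k\<in>G. \<integral>x. (\<Sum>l\<in>G. indicat_real (A k \<inter> A l) x) \<partial>M)"
      by (intro Bochner_Integration.integral_sum Bochner_Integration.integrable_sum int2)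
    also have "\<dots> = (\<Sum>k\<in>G. \<Sum>l\<in>G. \<integral>x. indicat_real (A k \<inter> A l) x \<partial>M)"
      by (intro sum.cong refl Bochner_Integration.integral_sum int2)
    also have "\<dots> = (\<Sum>k\<in>G. \<Sum>l\<in>G. prob (A k \<inter> A l))"
      using ev by (intro sum.cong refl) (simp add: sets.Int)
    finally show ?thesis .
  qed
  have E1: "(\<integral>x. (\<Sum>k\<in>G. indicat_real (A k) x) \<partial>M) = \<mu>"
    using int1 ev by (subst Bochner_Integration.integral_sum) (auto simp: \<mu>_def)
  have "(\<integral>x. (Z x - \<mu>)\<^sup>2 \<partial>M) = (\<Sum>k\<in>G. \<Sum>l\<in>G. prob (A k \<inter> A l)) - 2 * \<mu> * \<mu> + \<mu>\<^sup>2"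
  proof -
    have i1: "integrable M (\<lambda>x. \<Sum>k\<in>G. \<Sum>l\<in>G. indicat_real (A k \<inter> A l) x)"
      by (intro Bochner_Integration.integrable_sum int2)
    have i2: "integrable M (\<lambda>x. 2 * \<mu> * (\<Sum>k\<in>G. indicat_real (A k) x))"
      by (intro Bochner_Integration.integrable_sum integrable_mult_right int1)
    show ?thesis unfolding sq
      using i1 i2 E1 E2 by (simp add: prob_space)
  qed
  \<comment> \<open>The diagonal is treated generously: \<open>prob (A k)\<close> is bounded by
    \<open>prob (A k) * prob (A k) + prob (A k)\<close>, which completes the products to a full
    square.\<close>
  also have "(\<Sum>k\<in>G. \<Sum>l\<in>G. prob (A k \<inter> A l)) \<le> (\<Sum>k\<in>G. \<Sum>l\<in>G. prob (A k) * prob (A l) + (if k = l then prob (A k) else 0))"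
    by (intro sum_mono) (auto simp: indep)
  also have "\<dots> = \<mu>\<^sup>2 + \<mu>"
    using fin by (simp add: sum.distrib power2_eq_square sum_product \<mu>_def)
  finally have var: "(\<integral>x. (Z x - \<mu>)\<^sup>2 \<partial>M) \<le> \<mu>" by (simp add: power2_eq_square)
  have "\<mu>\<^sup>2 * prob ?V = (\<integral>x. \<mu>\<^sup>2 * indicat_real ?V x \<partial>M)"
    using V by simp
  also have "\<dots> \<le> (\<integral>x. (Z x - \<mu>)\<^sup>2 \<partial>M)"
  proof (rule integral_mono)
    show "integrable M (\<lambda>x. \<mu>\<^sup>2 * indicat_real ?V x)"
      using V by (intro integrable_mult_right integrable_real_indicator) (auto simp: emeasure_eq_measure)
    show "\<mu>\<^sup>2 * indicat_real ?V x \<le> (Z x - \<mu>)\<^sup>2" if "x \<in> space M" for x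
    proof (cases "x \<in> ?V")
      case True
      then have "Z x = 0" by (auto simp: Z_def)
      then show ?thesis using True by simp
    qed simp
  qed (rule intsq)
  finally have "\<mu> * (\<mu> * prob ?V) \<le> \<mu> * 1" using var by (simp add: power2_eq_square)
  then have "\<mu> * prob ?V \<le> 1" using pos unfolding \<mu>_def[symmetric] by (simp only: mult_le_cancel_left_pos)
  then show ?thesis using pos unfolding \<mu>_def[symmetric] by (simp add: field_simps)
qed

text \<open>Discarding a finite set \<open>F\<close> of indices leaves a divergent sum, so finite
  parts of the rest have arbitrarily large total probability, and avoiding all of the rest is a null
  event. There are only countably many \<open>F\<close>, and a point that lies in finitely many
  events avoids the rest for the \<open>F\<close> made of exactly those indices.\<close>

lemma borel_cantelli_pairwise_AE:
  assumes K: "countable K" and ev: "\<And>k. k \<in> K \<Longrightarrow> A k \<in> events"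
    and indep: "\<And>k l. k \<in> K \<Longrightarrow> l \<in> K \<Longrightarrow> k \<noteq> l \<Longrightarrow> prob (A k \<inter> A l) = prob (A k) * prob (A l)"
    and div: "\<not> (\<lambda>k. prob (A k)) summable_on K"
  shows "AE x in M. infinite {k \<in> K. x \<in> A k}"
proof -
  have large: "\<exists>G. finite G \<and> G \<subseteq> K - F \<and> (\<Sum>k\<in>G. prob (A k)) > B" if "finite F" for F B
  proof (rule ccontr)
    assume "\<not> ?thesis"
    then have "bdd_above (sum (\<lambda>k. prob (A k)) ` {G. G \<subseteq> K - F \<and> finite G})"
      by (intro bdd_aboveI[of _ B]) (force simp: not_less)
    then have "(\<lambda>k. prob (A k)) summable_on (K - F)"
      by (intro nonneg_bdd_above_summable_on) auto
    then have "(\<lambda>k. prob (A k)) summable_on ((K - F) \<union> (F \<inter> K))"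
      using that by (intro summable_on_Un_disjoint) (auto intro!: summable_on_finite)
    moreover have "(K - F) \<union> (F \<inter> K) = K" by auto
    ultimately show False using div by simp
  qed
  have null: "AE x in M. \<not> (\<forall>k\<in>K - F. x \<notin> A k)" if "finite F" for F
  proof -
    let ?V = "{x \<in> space M. \<forall>k\<in>K - F. x \<notin> A k}"
    have V: "?V \<in> events"
    proof -
      have "?V = space M - (\<Union>k\<in>K - F. A k)" by auto
      also have "\<dots> \<in> events"
        using K ev by (intro sets.Diff sets.top sets.countable_UN') auto
      finally show ?thesis .
    qed
    have "prob ?V \<le> e" if "e > 0" for e
    proof -
      obtain G where G: "finite G" "G \<subseteq> K - F" "(\<Sum>k\<in>G. prob (A k)) > 1 / e"
        using large[OF \<open>finite F\<close>] by blast
      have pos: "(\<Sum>k\<in>G. prob (A k)) > 0" using G(3) \<open>e > 0\<close> by (meson divide_pos_pos less_trans zero_less_one)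
      have "prob ?V \<le> prob {x \<in> space M. \<forall>k\<in>G. x \<notin> A k}"
      proof (rule finite_measure_mono)
        have "{x \<in> space M. \<forall>k\<in>G. x \<notin> A k} = space M - (\<Union>k\<in>G. A k)" by auto
        also have "\<dots> \<in> events"
          using G ev by (intro sets.Diff sets.top sets.finite_UN) auto
        finally show "{x \<in> space M. \<forall>k\<in>G. x \<notin> A k} \<in> events" .
      qed (use G in auto)
      also have "\<dots> \<le> 1 / (\<Sum>k\<in>G. prob (A k))"
        using G ev indep pos by (intro prob_avoid_all_le) (auto simp: subset_eq)
      also have "\<dots> \<le> e" using G(3) \<open>e > 0\<close> pos by (simp add: field_simps)
      finally show ?thesis .
    qed
    then have "prob ?V = 0"
      by (meson dense_ge measure_le_0_iff)
    then show ?thesis using V by (intro AE_I[of _ _ ?V]) (auto simp: emeasure_eq_measure)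
  qed
  have "countable {F. F \<subseteq> K \<and> finite F}"
    using K by (simp add: countable_Collect_finite_subset conj_commute)
  then have "AE x in M. \<forall>F\<in>{F. F \<subseteq> K \<and> finite F}. \<not> (\<forall>k\<in>K - F. x \<notin> A k)"
    using null by (simp only: AE_ball_countable) blast
  then show ?thesis
  proof eventually_elim
    case (elim x)
    show ?case
    proof
      assume "finite {k \<in> K. x \<in> A k}"
      with elim have "\<not> (\<forall>k\<in>K - {k \<in> K. x \<in> A k}. x \<notin> A k)" by (auto simp del: Diff_iff)
      then show False by auto
    qed
  qed
qed

end

section \<open>Linear forms modulo a prime\<close>

lemma mod_translate_cancel:
  fixes x u q :: nat
  assumes "x < q"
  shows "((x + u) mod q + (q - u mod q)) mod q = x"
proof -
  have "((x + u) mod q + (q - u mod q)) mod q = (x + u mod q + (q - u mod q)) mod q"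
    by (metis mod_add_left_eq mod_add_right_eq)
  also have "x + u mod q + (q - u mod q) = x + q" using assms by simp
  finally show ?thesis using assms by simp
qed

text \<open>Translation by \<open>t\<close> modulo \<open>q\<close> permutes the cube, and by
  \<open>trans\<close> a suitable one carries the fibre over \<open>w0\<close> onto the fibre over
  \<open>w\<close>, so all fibres have the same size. With one form or a pair of forms as
  \<open>F\<close>, this counts solutions without bases or ranks.\<close>

lemma card_fibre_translate:
  fixes F :: "('a \<Rightarrow> nat) \<Rightarrow> 'b"
  assumes I: "finite I" and q: "q > 0" and W: "finite W" and w0: "w0 \<in> W"
    and FW: "\<And>b. b \<in> I \<rightarrow>\<^sub>E {..<q} \<Longrightarrow> F b \<in> W"
    and trans: "\<And>w. w \<in> W \<Longrightarrow> \<exists>t. \<forall>b\<in>I \<rightarrow>\<^sub>E {..<q}. F (\<lambda>p\<in>I. (b p + t p) mod q) = w \<longleftrightarrow> F b = w0"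
  shows "card (I \<rightarrow>\<^sub>E {..<q}) = card W * card {b \<in> I \<rightarrow>\<^sub>E {..<q}. F b = w0}"
proof -
  let ?A = "I \<rightarrow>\<^sub>E {..<q}"
  have finA: "finite ?A" using I by (intro finite_PiE) auto
  have fibre: "card {b \<in> ?A. F b = w} = card {b \<in> ?A. F b = w0}" if w: "w \<in> W" for w
  proof -
    obtain t where t: "\<And>b. b \<in> ?A \<Longrightarrow> F (\<lambda>p\<in>I. (b p + t p) mod q) = w \<longleftrightarrow> F b = w0"
      using trans[OF w] by blast
    define \<tau> where "\<tau> b = (\<lambda>p\<in>I. (b p + t p) mod q)" for b :: "'a \<Rightarrow> nat"
    have into: "\<tau> ` ?A \<subseteq> ?A" using q by (auto simp: \<tau>_def PiE_iff)
    have inj: "inj_on \<tau> ?A"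
    proof (rule inj_onI)
      fix b b' assume b: "b \<in> ?A" "b' \<in> ?A" and eq: "\<tau> b = \<tau> b'"
      show "b = b'"
      proof (rule PiE_ext[OF b])
        fix p assume p: "p \<in> I"
        have "(b p + t p) mod q = (b' p + t p) mod q"
          using fun_cong[OF eq, of p] p by (simp add: \<tau>_def)
        moreover have "b p < q" "b' p < q" using b p by (auto simp: PiE_iff)
        ultimately show "b p = b' p"
          using mod_translate_cancel[of "b p" q "t p"] mod_translate_cancel[of "b' p" q "t p"] by simp
      qed
    qed
    have surj: "\<tau> ` ?A = ?A" using endo_inj_surj[OF finA into inj] .
    have "{b \<in> ?A. F b = w} = \<tau> ` {b \<in> ?A. F b = w0}"
    proof (intro equalityI subsetI)
      fix b assume b: "b \<in> {b \<in> ?A. F b = w}"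
      then obtain a where "a \<in> ?A" "b = \<tau> a" using surj by blast
      then show "b \<in> \<tau> ` {b \<in> ?A. F b = w0}" using t[of a] b by (auto simp: \<tau>_def)
    next
      fix b assume "b \<in> \<tau> ` {b \<in> ?A. F b = w0}"
      then obtain a where a: "a \<in> ?A" "b = \<tau> a" "F a = w0" by blast
      then have "b \<in> ?A" using into by blast
      then show "b \<in> {b \<in> ?A. F b = w}" using t[of a] a by (simp add: \<tau>_def)
    qed
    then show ?thesis using inj by (simp add: card_image inj_on_subset)
  qed
  have "?A = (\<Union>w\<in>W. {b \<in> ?A. F b = w})" using FW by auto
  then have "card ?A = card (\<Union>w\<in>W. {b \<in> ?A. F b = w})" by simp
  also have "\<dots> = (\<Sum>w\<in>W. card {b \<in> ?A. F b = w})"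
    using W finA by (intro card_UN_disjoint) auto
  also have "\<dots> = card W * card {b \<in> ?A. F b = w0}" using fibre by simp
  finally show ?thesis .
qed

text \<open>Summing over the support keeps the index set out of the definition, so forms with
  different supports can be compared on one common box.\<close>

definition lin_form :: "nat \<Rightarrow> ('a \<Rightarrow> nat) \<Rightarrow> ('a \<Rightarrow> nat) \<Rightarrow> nat" where
  "lin_form q k b = (\<Sum>p | k p \<noteq> 0. k p * b p) mod q"

lemma lin_form_eq:
  assumes "finite I" "{p. k p \<noteq> 0} \<subseteq> I"
  shows "lin_form q k b = (\<Sum>p\<in>I. k p * b p) mod q"
  unfolding lin_form_def using assms by (subst sum.mono_neutral_left[of I]) auto

lemma lin_form_translate:
  assumes "{p. k p \<noteq> 0} \<subseteq> I"
  shows "lin_form q k (\<lambda>p\<in>I. (b p + t p) mod q) = (lin_form q k b + lin_form q k t) mod q"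
proof -
  have "lin_form q k (\<lambda>p\<in>I. (b p + t p) mod q) = (\<Sum>p | k p \<noteq> 0. k p * ((b p + t p) mod q)) mod q"
    unfolding lin_form_def using assms by (intro arg_cong[where f="\<lambda>x. x mod q"] sum.cong) auto
  also have "\<dots> = (\<Sum>p | k p \<noteq> 0. (k p * ((b p + t p) mod q)) mod q) mod q"
    by (rule mod_sum_eq[symmetric])
  also have "\<dots> = (\<Sum>p | k p \<noteq> 0. (k p * (b p + t p)) mod q) mod q"
    by (simp add: mod_mult_right_eq)
  also have "\<dots> = (\<Sum>p | k p \<noteq> 0. k p * (b p + t p)) mod q"
    by (rule mod_sum_eq)
  also have "\<dots> = (lin_form q k b + lin_form q k t) mod q"
    by (simp add: lin_form_def algebra_simps sum.distrib mod_add_eq)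
  finally show ?thesis .
qed

lemma mod_translate_eq_iff:
  fixes x w q :: nat
  assumes "x < q"
  shows "(x + w) mod q = w mod q \<longleftrightarrow> x = 0"
proof
  assume "(x + w) mod q = w mod q"
  then have "q dvd x" by (metis add.commute add_diff_cancel_left' le_add1 mod_eq_dvd_iff_nat)
  then show "x = 0" using assms by (auto dest: dvd_imp_le)
qed simp

lemma ex_lin_form_pair_eq:
  fixes k k' :: "'a \<Rightarrow> nat"
  assumes q: "prime q" and I: "finite {p. k p \<noteq> 0}" "finite {p. k' p \<noteq> 0}"
    and det: "\<not> int q dvd int (k a) * int (k' c) - int (k c) * int (k' a)"
  shows "\<exists>t. lin_form q k t = w mod q \<and> lin_form q k' t = w' mod q"
proof -
  have ac: "a \<noteq> c" using det by auto
  let ?D = "int (k a) * int (k' c) - int (k c) * int (k' a)"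
  have "coprime (int q) ?D" using q det by (intro prime_imp_coprime) auto
  then obtain u v where uv: "u * int q + v * ?D = 1"
    using bezout_int[of "int q" ?D] by (auto simp: coprime_iff_gcd_eq_1)
  have q0: "int q > 0" using q prime_gt_0_nat by simp
  \<comment> \<open>Cramer's rule for the unknowns at \<open>a\<close> and \<open>c\<close>, with
    \<open>v\<close> as the inverse of the minor \<open>?D\<close> modulo \<open>q\<close>.\<close>
  define x where "x = v * (int w * int (k' c) - int w' * int (k c))"
  define y where "y = v * (int w' * int (k a) - int w * int (k' a))"
  define t where "t p = (if p = a then nat (x mod int q) else if p = c then nat (y mod int q) else 0)" for p
  have form: "int (lin_form q l t) = (int (l a) * x + int (l c) * y) mod int q"
    if "finite {p. l p \<noteq> 0}" for l
  proof -
    have "int (lin_form q l t) = (\<Sum>p\<in>insert a (insert c {p. l p \<noteq> 0}). int (l p) * int (t p)) mod int q"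
      using that by (subst lin_form_eq[of "insert a (insert c {p. l p \<noteq> 0})"]) (auto simp: zmod_int)
    also have "(\<Sum>p\<in>insert a (insert c {p. l p \<noteq> 0}). int (l p) * int (t p)) = (\<Sum>p\<in>{a,c}. int (l p) * int (t p))"
      using that by (intro sum.mono_neutral_right) (auto simp: t_def)
    also have "\<dots> = int (l a) * (x mod int q) + int (l c) * (y mod int q)"
      using ac q0 by (simp add: t_def)
    also have "\<dots> mod int q = (int (l a) * x + int (l c) * y) mod int q"
      by (intro mod_add_cong mod_mult_right_eq)
    finally show ?thesis .
  qed
  have "int (k a) * x + int (k c) * y = int w * (v * ?D)" by (simp add: x_def y_def algebra_simps)
  also have "v * ?D = 1 - u * int q" using uv by simp
  also have "int w * (1 - u * int q) = int w + (- int w * u) * int q" by (simp add: algebra_simps)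
  finally have "int (lin_form q k t) = int w mod int q"
    unfolding form[OF I(1)] by (simp only: mod_mult_self1)
  moreover have "int (k' a) * x + int (k' c) * y = int w' * (v * ?D)" by (simp add: x_def y_def algebra_simps)
  then have "int (k' a) * x + int (k' c) * y = int w' * (1 - u * int q)" using uv by simp
  then have "int (k' a) * x + int (k' c) * y = int w' + (- int w' * u) * int q" by (simp add: algebra_simps)
  then have "int (lin_form q k' t) = int w' mod int q"
    unfolding form[OF I(2)] by (simp only: mod_mult_self1)
  ultimately show ?thesis by (metis zmod_int of_nat_eq_iff)
qed

lemma ex_lin_form_eq:
  fixes k :: "'a \<Rightarrow> nat"
  assumes q: "prime q" and I: "finite {p. k p \<noteq> 0}" and a: "\<not> q dvd k a"
  shows "\<exists>t. lin_form q k t = w mod q"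
proof -
  have "coprime (int q) (int (k a))" using q a by (intro prime_imp_coprime) auto
  then obtain u v where uv: "u * int q + v * int (k a) = 1"
    using bezout_int[of "int q" "int (k a)"] by (auto simp: coprime_iff_gcd_eq_1)
  have q0: "int q > 0" using q prime_gt_0_nat by simp
  define t where "t p = (if p = a then nat ((v * int w) mod int q) else 0)" for p
  have "k a \<noteq> 0" using a by (metis dvd_0_right)
  then have "int (lin_form q k t) = (\<Sum>p | k p \<noteq> 0. if p = a then int (k a) * ((v * int w) mod int q) else 0) mod int q"
    unfolding lin_form_def of_nat_mod of_nat_sum using q0
    by (intro arg_cong[where f="\<lambda>x. x mod int q"] sum.cong) (auto simp: t_def)
  also have "\<dots> = (int (k a) * (v * int w)) mod int q"
    using I \<open>k a \<noteq> 0\<close> by (simp add: mod_simps)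
  also have "int (k a) * (v * int w) = int w * (1 - u * int q)" using uv
    by (metis add_diff_cancel_left' mult.assoc mult.commute)
  also have "\<dots> = int w + (- int w * u) * int q" by (simp add: algebra_simps)
  finally have "int (lin_form q k t) = int w mod int q" by (simp only: mod_mult_self1)
  then show ?thesis by (metis zmod_int of_nat_eq_iff)
qed

lemma card_lin_form_zero:
  assumes q: "prime q" and I: "finite I" "{p. k p \<noteq> 0} \<subseteq> I" and a: "\<not> q dvd k a"
  shows "card (I \<rightarrow>\<^sub>E {..<q}) = q * card {b \<in> I \<rightarrow>\<^sub>E {..<q}. lin_form q k b = 0}"
proof -
  have q0: "q > 0" using q prime_gt_0_nat by simp
  have fin: "finite {p. k p \<noteq> 0}" using I finite_subset by blast
  have "card (I \<rightarrow>\<^sub>E {..<q}) = card {..<q} * card {b \<in> I \<rightarrow>\<^sub>E {..<q}. lin_form q k b = 0}"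
  proof (rule card_fibre_translate[OF I(1) q0])
    fix w assume w: "w \<in> {..<q}"
    obtain t where t: "lin_form q k t = w mod q" using ex_lin_form_eq[OF q fin a] by blast
    have "lin_form q k (\<lambda>p\<in>I. (b p + t p) mod q) = w \<longleftrightarrow> lin_form q k b = 0" for b
      using mod_translate_eq_iff[of "lin_form q k b" q w] w q0
      by (simp add: lin_form_translate[OF I(2)] t) (simp add: lin_form_def)
    then show "\<exists>t. \<forall>b\<in>I \<rightarrow>\<^sub>E {..<q}. lin_form q k (\<lambda>p\<in>I. (b p + t p) mod q) = w \<longleftrightarrow> lin_form q k b = 0"
      by blast
  qed (use q0 in \<open>auto simp: lin_form_def\<close>)
  then show ?thesis by simp
qed

text \<open>A 2 by 2 minor that is invertible modulo \<open>q\<close> makes the pair of forms reach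
  every pair of residues, and all fibres have the same size.\<close>

lemma card_lin_form_pair_zero:
  assumes q: "prime q" and I: "finite I" "{p. k p \<noteq> 0} \<subseteq> I" "{p. k' p \<noteq> 0} \<subseteq> I"
    and det: "\<not> int q dvd int (k a) * int (k' c) - int (k c) * int (k' a)"
  shows "card (I \<rightarrow>\<^sub>E {..<q}) = q * q * card {b \<in> I \<rightarrow>\<^sub>E {..<q}. lin_form q k b = 0 \<and> lin_form q k' b = 0}"
proof -
  have q0: "q > 0" using q prime_gt_0_nat by simp
  have fin: "finite {p. k p \<noteq> 0}" "finite {p. k' p \<noteq> 0}" using I finite_subset by blast+
  let ?F = "\<lambda>b. (lin_form q k b, lin_form q k' b)"
  have "card (I \<rightarrow>\<^sub>E {..<q}) = card ({..<q} \<times> {..<q}) * card {b \<in> I \<rightarrow>\<^sub>E {..<q}. ?F b = (0, 0)}"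
  proof (rule card_fibre_translate[OF I(1) q0])
    fix w assume "w \<in> {..<q} \<times> {..<q}"
    then obtain w1 w2 where w: "w = (w1, w2)" "w1 < q" "w2 < q" by auto
    obtain t where t: "lin_form q k t = w1 mod q" "lin_form q k' t = w2 mod q"
      using ex_lin_form_pair_eq[OF q fin det] by blast
    have "?F (\<lambda>p\<in>I. (b p + t p) mod q) = w \<longleftrightarrow> ?F b = (0, 0)" for b
      using mod_translate_eq_iff[of "lin_form q k b" q w1] mod_translate_eq_iff[of "lin_form q k' b" q w2] w q0
      by (simp add: lin_form_translate[OF I(2)] lin_form_translate[OF I(3)] t) (simp add: lin_form_def)
    then show "\<exists>t. \<forall>b\<in>I \<rightarrow>\<^sub>E {..<q}. ?F (\<lambda>p\<in>I. (b p + t p) mod q) = w \<longleftrightarrow> ?F b = (0, 0)"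
      by blast
  qed (use q0 in \<open>auto simp: lin_form_def\<close>)
  then show ?thesis by (simp add: card_cartesian_product)
qed

section \<open>Distribution of the matrix entries\<close>

lemma PiM_Collect:
  fixes M :: "'i \<Rightarrow> 'a measure"
  assumes M: "\<And>i. prob_space (M i)" and J: "J \<subseteq> I" "finite J" and X: "\<And>i. i \<in> J \<Longrightarrow> X i \<in> sets (M i)"
  shows sets_PiM_Collect: "{x \<in> space (PiM I M). \<forall>i\<in>J. x i \<in> X i} \<in> sets (PiM I M)"
    and measure_PiM_Collect: "measure (PiM I M) {x \<in> space (PiM I M). \<forall>i\<in>J. x i \<in> X i} = (\<Prod>i\<in>J. measure (M i) (X i))"
proof -
  interpret product_prob_space M I
    using M by (rule product_prob_spaceI)
  have eq: "{x \<in> space (PiM I M). \<forall>i\<in>J. x i \<in> X i} = prod_emb I M J (Pi\<^sub>E J X)"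
    unfolding prod_emb_def using J X by (auto simp: space_PiM Pi_iff)
  show "{x \<in> space (PiM I M). \<forall>i\<in>J. x i \<in> X i} \<in> sets (PiM I M)"
    unfolding eq using J X by (intro sets_PiM_I) auto
  show "measure (PiM I M) {x \<in> space (PiM I M). \<forall>i\<in>J. x i \<in> X i} = (\<Prod>i\<in>J. measure (M i) (X i))"
    unfolding eq using J X by (rule measure_PiM_emb)
qed

lemma prob_space_row_measure: "q > 0 \<Longrightarrow> prob_space (row_measure q)"
  unfolding row_measure_def by (intro prob_space_PiM prob_space_uniform_count_measure) auto

lemma prob_space_matrix_measure: "q > 0 \<Longrightarrow> prob_space (matrix_measure q)"
  unfolding matrix_measure_def by (intro prob_space_PiM prob_space_row_measure)

lemma prob_space_matrix_tuple_measure: "q > 0 \<Longrightarrow> prob_space (matrix_tuple_measure q s)"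
  unfolding matrix_tuple_measure_def by (intro prob_space_PiM prob_space_matrix_measure)

lemma space_matrix_tuple_measure:
  "space (matrix_tuple_measure q s) = {..<s} \<rightarrow>\<^sub>E UNIV \<rightarrow>\<^sub>E UNIV \<rightarrow>\<^sub>E {..<q}"
  by (simp add: matrix_tuple_measure_def matrix_measure_def row_measure_def space_PiM space_uniform_count_measure)

text \<open>The measure is a product of products of products, so the probability is collected level
  by level: \<open>X\<close> fixes the start of a row, \<open>Y\<close> the first rows of a
  matrix.\<close>

lemma matrix_tuple_cylinder:
  fixes a :: "nat \<Rightarrow> nat \<Rightarrow> nat \<Rightarrow> nat"
  defines "Z \<equiv> \<lambda>q s D R a. {C \<in> space (matrix_tuple_measure q s). \<forall>j\<in>{..<s}. \<forall>i\<in>{..<D}. \<forall>r\<in>{..<R}. C j i r = a j i r}"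
  assumes q: "q > 0" and a: "\<And>j i r. j < s \<Longrightarrow> i < D \<Longrightarrow> r < R \<Longrightarrow> a j i r < q"
  shows sets_matrix_tuple_cylinder: "Z q s D R a \<in> sets (matrix_tuple_measure q s)"
    and measure_matrix_tuple_cylinder: "measure (matrix_tuple_measure q s) (Z q s D R a) = (1 / real q) ^ (s * D * R)"
proof -
  define X where "X b = {x \<in> space (row_measure q). \<forall>r\<in>{..<R}. x r \<in> {b r}}" for b
  define Y where "Y b = {x \<in> space (matrix_measure q). \<forall>i\<in>{..<D}. x i \<in> X (b i)}" for b
  have q': "prob_space (uniform_count_measure {..<q})"
    using q by (intro prob_space_uniform_count_measure) auto
  have X: "X b \<in> sets (row_measure q)" "measure (row_measure q) (X b) = (1 / real q) ^ R"
    if "\<And>r. r < R \<Longrightarrow> b r < q" for b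
  proof -
    show "X b \<in> sets (row_measure q)"
      unfolding X_def row_measure_def using that
      by (intro sets_PiM_Collect q') (auto simp: sets_uniform_count_measure)
    have "measure (row_measure q) (X b) = (\<Prod>r\<in>{..<R}. measure (uniform_count_measure {..<q}) {b r})"
      unfolding X_def row_measure_def using that
      by (intro measure_PiM_Collect q') (auto simp: sets_uniform_count_measure)
    also have "\<dots> = (\<Prod>r\<in>{..<R}. 1 / real q)"
      using that by (intro prod.cong refl) (auto simp: measure_uniform_count_measure)
    finally show "measure (row_measure q) (X b) = (1 / real q) ^ R" by simp
  qed
  have Y: "Y b \<in> sets (matrix_measure q)" "measure (matrix_measure q) (Y b) = (1 / real q) ^ (D * R)"
    if "\<And>i r. i < D \<Longrightarrow> r < R \<Longrightarrow> b i r < q" for b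
  proof -
    note p = prob_space_row_measure[OF q]
    show "Y b \<in> sets (matrix_measure q)"
      unfolding Y_def matrix_measure_def using that by (intro sets_PiM_Collect p X) auto
    have "measure (matrix_measure q) (Y b) = (\<Prod>i\<in>{..<D}. measure (row_measure q) (X (b i)))"
      unfolding Y_def matrix_measure_def using that by (intro measure_PiM_Collect p X) auto
    also have "\<dots> = (\<Prod>i\<in>{..<D}. (1 / real q) ^ R)"
      using that by (intro prod.cong refl X) auto
    finally show "measure (matrix_measure q) (Y b) = (1 / real q) ^ (D * R)"
      by (simp add: power_mult[symmetric] mult.commute power_one_over)
  qed
  note p = prob_space_matrix_measure[OF q]
  have Z: "Z q s D R a = {C \<in> space (matrix_tuple_measure q s). \<forall>j\<in>{..<s}. C j \<in> Y (a j)}"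
    unfolding Z_def X_def Y_def by (auto simp: matrix_tuple_measure_def matrix_measure_def row_measure_def space_PiM PiE_iff)
  show "Z q s D R a \<in> sets (matrix_tuple_measure q s)"
    unfolding Z unfolding matrix_tuple_measure_def using a by (intro sets_PiM_Collect p Y) auto
  have "measure (matrix_tuple_measure q s) (Z q s D R a) = (\<Prod>j\<in>{..<s}. measure (matrix_measure q) (Y (a j)))"
    unfolding Z unfolding matrix_tuple_measure_def using a by (intro measure_PiM_Collect p Y) auto
  also have "\<dots> = (\<Prod>j\<in>{..<s}. (1 / real q) ^ (D * R))"
    using a by (intro prod.cong refl Y) auto
  finally show "measure (matrix_tuple_measure q s) (Z q s D R a) = (1 / real q) ^ (s * D * R)"
    by (simp add: power_mult[symmetric] mult.commute mult.left_commute power_one_over)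
qed

text \<open>The measure groups the entries by rows, whereas a linear form constrains columns.
  Splitting the event into the disjoint cylinders that prescribe the whole \<open>D\<close> by
  \<open>R\<close> corner of every matrix reduces the regrouping to counting, and the count is a
  product over columns.\<close>

lemma matrix_tuple_columns:
  fixes B :: "nat \<Rightarrow> (nat \<times> nat \<Rightarrow> nat) set" and s D R q :: nat
  defines "I \<equiv> {..<s} \<times> {..<D}"
  defines "V \<equiv> {C \<in> space (matrix_tuple_measure q s). \<forall>r<R. (\<lambda>(j, i)\<in>I. C j i r) \<in> B r}"
  assumes q: "q > 0"
  shows sets_matrix_tuple_columns: "V \<in> sets (matrix_tuple_measure q s)"
    and measure_matrix_tuple_columns: "measure (matrix_tuple_measure q s) V
          = (\<Prod>r<R. real (card {b \<in> I \<rightarrow>\<^sub>E {..<q}. b \<in> B r}) / real (card (I \<rightarrow>\<^sub>E {..<q})))"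
proof -
  let ?M = "matrix_tuple_measure q s"
  interpret prob_space ?M using q by (rule prob_space_matrix_tuple_measure)
  define S where "S = (\<Pi>\<^sub>E r\<in>{..<R}. {b \<in> I \<rightarrow>\<^sub>E {..<q}. b \<in> B r})"
  define Z where "Z a = {C \<in> space ?M. \<forall>j\<in>{..<s}. \<forall>i\<in>{..<D}. \<forall>r\<in>{..<R}. C j i r = a r (j, i)}"
    for a :: "nat \<Rightarrow> nat \<times> nat \<Rightarrow> nat"
  have finI: "finite I" by (simp add: I_def)
  have finA: "finite (I \<rightarrow>\<^sub>E {..<q})" using finI by (intro finite_PiE) auto
  have finS: "finite S" unfolding S_def using finA by (intro finite_PiE) auto
  have aq: "a r (j, i) < q" if "a \<in> S" "j < s" "i < D" "r < R" for a j i r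
    using that by (force simp: S_def I_def PiE_iff)
  have Zs: "Z a \<in> events" "prob (Z a) = (1 / real q) ^ (s * D * R)" if "a \<in> S" for a
    unfolding Z_def using aq[OF that] q
    by (intro sets_matrix_tuple_cylinder measure_matrix_tuple_cylinder; simp)+
  have col: "(\<lambda>(j, i)\<in>I. C j i r) \<in> I \<rightarrow>\<^sub>E {..<q}" if "C \<in> space ?M" for C r
    using that unfolding space_matrix_tuple_measure I_def by (auto simp: PiE_iff)
  have V: "V = (\<Union>a\<in>S. Z a)"
  proof (intro equalityI subsetI)
    fix C assume C: "C \<in> V"
    define a where "a = (\<lambda>r\<in>{..<R}. \<lambda>(j, i)\<in>I. C j i r)"
    have "a \<in> S" using C col by (auto simp: a_def S_def V_def)
    moreover have "C \<in> Z a" using C by (auto simp: a_def Z_def V_def I_def)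
    ultimately show "C \<in> (\<Union>a\<in>S. Z a)" by blast
  next
    fix C assume "C \<in> (\<Union>a\<in>S. Z a)"
    then obtain a where a: "a \<in> S" "C \<in> Z a" by blast
    have "(\<lambda>(j, i)\<in>I. C j i r) = a r" if "r < R" for r
    proof (rule PiE_ext[OF col])
      show "C \<in> space ?M" using a by (simp add: Z_def)
      show "a r \<in> I \<rightarrow>\<^sub>E {..<q}" using a that by (auto simp: S_def)
    qed (use a that in \<open>auto simp: Z_def I_def\<close>)
    then show "C \<in> V" using a by (auto simp: V_def S_def Z_def PiE_iff)
  qed
  show "V \<in> events" unfolding V using finS Zs by auto
  have disj: "disjoint_family_on Z S"
  proof (unfold disjoint_family_on_def, intro ballI impI)
    fix a a' assume aa: "a \<in> S" "a' \<in> S" "a \<noteq> a'"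
    show "Z a \<inter> Z a' = {}"
    proof (rule ccontr)
      assume "Z a \<inter> Z a' \<noteq> {}"
      then obtain C where C: "C \<in> Z a" "C \<in> Z a'" by blast
      have "a = a'"
      proof (rule PiE_ext[OF aa(1,2)[unfolded S_def]])
        fix r assume r: "r \<in> {..<R}"
        then have "a r \<in> I \<rightarrow>\<^sub>E {..<q}" "a' r \<in> I \<rightarrow>\<^sub>E {..<q}" using aa by (auto simp: S_def PiE_iff)
        then show "a r = a' r"
          by (rule PiE_ext) (use C r in \<open>auto simp: Z_def I_def\<close>)
      qed
      with aa show False by simp
    qed
  qed
  have "prob V = (\<Sum>a\<in>S. prob (Z a))"
    unfolding V using finS Zs disj by (intro finite_measure_finite_Union) auto
  also have "\<dots> = real (card S) * (1 / real q) ^ (s * D * R)" using Zs by simp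
  also have "card S = (\<Prod>r<R. card {b \<in> I \<rightarrow>\<^sub>E {..<q}. b \<in> B r})"
    unfolding S_def by (subst card_PiE) auto
  also have "real \<dots> * (1 / real q) ^ (s * D * R) =
      (\<Prod>r<R. real (card {b \<in> I \<rightarrow>\<^sub>E {..<q}. b \<in> B r}) / real (card (I \<rightarrow>\<^sub>E {..<q})))"
    using finI by (simp add: card_PiE I_def prod_dividef power_one_over power_mult)
  finally show "prob V = (\<Prod>r<R. real (card {b \<in> I \<rightarrow>\<^sub>E {..<q}. b \<in> B r}) / real (card (I \<rightarrow>\<^sub>E {..<q})))" .
qed

section \<open>Vanishing events: probability and pairwise independence\<close>

definition vanishing :: "nat \<Rightarrow> nat \<Rightarrow> nat \<Rightarrow> (nat \<times> nat \<Rightarrow> nat) \<Rightarrow> (nat \<Rightarrow> nat \<Rightarrow> nat \<Rightarrow> nat) set" where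
  "vanishing q s L k = {C \<in> space (matrix_tuple_measure q s). \<forall>r<L. lin_form q k (\<lambda>(j, i). C j i r) = 0}"

lemma lin_form_restrict:
  assumes "{p. k p \<noteq> 0} \<subseteq> I"
  shows "lin_form q k (restrict b I) = lin_form q k b"
  unfolding lin_form_def using assms by (intro arg_cong[where f="\<lambda>x. x mod q"] sum.cong) auto

lemma ex_box_supset:
  fixes A :: "(nat \<times> nat) set"
  assumes "finite A" "A \<subseteq> {..<s} \<times> UNIV"
  obtains D where "A \<subseteq> {..<s} \<times> {..<D}"
proof -
  obtain D where "\<forall>i\<in>snd ` A. i < D"
    using assms(1) by (metis finite_imageI finite_nat_set_iff_bounded)
  then show ?thesis using assms(2) by (intro that[of D]) auto
qed

lemma vanishing_prob:
  assumes q: "prime q" and k: "finite {p. k p \<noteq> 0}" "{p. k p \<noteq> 0} \<subseteq> {..<s} \<times> UNIV" "\<not> q dvd k a"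
  shows sets_vanishing: "vanishing q s L k \<in> sets (matrix_tuple_measure q s)"
    and measure_vanishing: "measure (matrix_tuple_measure q s) (vanishing q s L k) = 1 / real q ^ L"
proof -
  have q0: "q > 0" using q prime_gt_0_nat by simp
  obtain D where D: "{p. k p \<noteq> 0} \<subseteq> {..<s} \<times> {..<D}" using ex_box_supset k by blast
  let ?I = "{..<s} \<times> {..<D}"
  define B where "B r = {b. lin_form q k b = 0}" for r :: nat
  have eq: "vanishing q s L k = {C \<in> space (matrix_tuple_measure q s). \<forall>r<L. (\<lambda>(j, i)\<in>?I. C j i r) \<in> B r}"
    using lin_form_restrict[OF D] by (simp add: vanishing_def B_def)
  show "vanishing q s L k \<in> sets (matrix_tuple_measure q s)"
    unfolding eq using q0 by (rule sets_matrix_tuple_columns)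
  have card: "card (?I \<rightarrow>\<^sub>E {..<q}) = q * card {b \<in> ?I \<rightarrow>\<^sub>E {..<q}. b \<in> B r}" for r
    using card_lin_form_zero[OF q _ D k(3)] by (simp add: B_def)
  have "card (?I \<rightarrow>\<^sub>E {..<q}) > 0" using q0 by (simp add: card_PiE)
  then have "real (card {b \<in> ?I \<rightarrow>\<^sub>E {..<q}. b \<in> B r}) / real (card (?I \<rightarrow>\<^sub>E {..<q})) = 1 / real q" for r
    using card[of r] q0 by (simp add: field_simps)
  then show "measure (matrix_tuple_measure q s) (vanishing q s L k) = 1 / real q ^ L"
    unfolding eq using measure_matrix_tuple_columns[OF q0, of s L D B] by (simp add: power_one_over)
qed

text \<open>The depths \<open>L\<close> and \<open>L'\<close> may differ. Columns below both carry
  two independent equations, the remaining columns below the larger one only a single equation.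
  \<open>B r\<close> encodes both cases, and the factors over all columns multiply to the product of
  the two probabilities.\<close>

lemma measure_vanishing_Int:
  assumes q: "prime q" and k: "finite {p. k p \<noteq> 0}" "{p. k p \<noteq> 0} \<subseteq> {..<s} \<times> UNIV"
    and k': "finite {p. k' p \<noteq> 0}" "{p. k' p \<noteq> 0} \<subseteq> {..<s} \<times> UNIV"
    and det: "\<not> int q dvd int (k a) * int (k' c) - int (k c) * int (k' a)"
  shows "measure (matrix_tuple_measure q s) (vanishing q s L k \<inter> vanishing q s L' k') = 1 / real q ^ L * (1 / real q ^ L')"
proof -
  have q0: "q > 0" using q prime_gt_0_nat by simp
  obtain D where D: "{p. k p \<noteq> 0} \<union> {p. k' p \<noteq> 0} \<subseteq> {..<s} \<times> {..<D}"
    using ex_box_supset[of "{p. k p \<noteq> 0} \<union> {p. k' p \<noteq> 0}" s] k k' by blast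
  then have D: "{p. k p \<noteq> 0} \<subseteq> {..<s} \<times> {..<D}" "{p. k' p \<noteq> 0} \<subseteq> {..<s} \<times> {..<D}" by auto
  let ?I = "{..<s} \<times> {..<D}"
  \<comment> \<open>Each form is nonzero modulo \<open>q\<close> by itself, since otherwise
    \<open>q\<close> would divide the minor. This serves the columns with only one equation.\<close>
  obtain e where e: "\<not> q dvd k e"
    using det by (metis dvd_diff dvd_mult2 of_nat_dvd_iff)
  obtain e' where e': "\<not> q dvd k' e'"
    using det by (metis dvd_diff dvd_mult of_nat_dvd_iff)
  define B where "B r = {b. (r < L \<longrightarrow> lin_form q k b = 0) \<and> (r < L' \<longrightarrow> lin_form q k' b = 0)}" for r
  let ?R = "max L L'"
  have eq: "vanishing q s L k \<inter> vanishing q s L' k'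
      = {C \<in> space (matrix_tuple_measure q s). \<forall>r<?R. (\<lambda>(j, i)\<in>?I. C j i r) \<in> B r}"
    using lin_form_restrict[OF D(1)] lin_form_restrict[OF D(2)] by (auto simp: vanishing_def B_def)
  have pos: "card (?I \<rightarrow>\<^sub>E {..<q}) > 0" using q0 by (simp add: card_PiE)
  let ?a = "real (card (?I \<rightarrow>\<^sub>E {..<q}))"
  have div: "real x = real y / real p" if "y = p * x" "p > 0" for x y p :: nat
    using that by simp
  have c: "real (card {b \<in> ?I \<rightarrow>\<^sub>E {..<q}. lin_form q k b = 0}) = ?a / real q"
    "real (card {b \<in> ?I \<rightarrow>\<^sub>E {..<q}. lin_form q k' b = 0}) = ?a / real q"
    "real (card {b \<in> ?I \<rightarrow>\<^sub>E {..<q}. lin_form q k b = 0 \<and> lin_form q k' b = 0}) = ?a / (real q * real q)"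
    using div[OF card_lin_form_zero[OF q _ D(1) e]] div[OF card_lin_form_zero[OF q _ D(2) e']]
      div[OF card_lin_form_pair_zero[OF q _ D det]] q0 by simp_all
  have a: "?a \<noteq> 0" using pos by simp
  have fac: "real (card {b \<in> ?I \<rightarrow>\<^sub>E {..<q}. b \<in> B r}) / ?a
      = (if r < L then 1 / real q else 1) * (if r < L' then 1 / real q else 1)" for r
    by (cases "r < L"; cases "r < L'") (simp_all only: B_def mem_Collect_eq c simp_thms if_True if_False, use a in auto)
  have "{..<?R} \<inter> {r. r < L} = {..<L}" "{..<?R} \<inter> {r. r < L'} = {..<L'}" by auto
  then have "(\<Prod>r<?R. (if r < L then 1 / real q else 1) * (if r < L' then 1 / real q else 1)) = 1 / real q ^ L * (1 / real q ^ L')"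
    unfolding prod.distrib by (simp add: prod.If_cases power_one_over)
  then show ?thesis
    unfolding eq using measure_matrix_tuple_columns[OF q0, of s ?R D B] fac by simp
qed

section \<open>From a vanishing linear form to the discrepancy\<close>

lemma discrepancy_le_star_discrepancy:
  assumes x: "\<And>j. j < s \<Longrightarrow> 0 \<le> x j \<and> x j \<le> 1"
  shows "\<bar>discrepancy_function s X x N\<bar> \<le> star_discrepancy s X N"
proof -
  have bdd: "bdd_above ((\<lambda>x. \<bar>discrepancy_function s X x N\<bar>) ` ({..<s} \<rightarrow>\<^sub>E {0..1}))"
  proof (rule bdd_aboveI2)
    fix y :: "nat \<Rightarrow> real" assume "y \<in> {..<s} \<rightarrow>\<^sub>E {0..1}"
    then have y: "0 \<le> y j \<and> y j \<le> 1" if "j < s" for j using that by (force simp: PiE_iff)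
    have "card {n. n < N \<and> (\<forall>j<s. X n j \<in> {0..<y j})} \<le> card {..<N}"
      by (intro card_mono) auto
    moreover have "(\<Prod>j<s. y j) \<le> 1" using y by (intro prod_le_1) auto
    then have "real N * (\<Prod>j<s. y j) \<le> real N" by (simp add: mult_left_le)
    moreover have "0 \<le> real N * (\<Prod>j<s. y j)" using y by (intro mult_nonneg_nonneg prod_nonneg) auto
    ultimately show "\<bar>discrepancy_function s X y N\<bar> \<le> real N"
      unfolding discrepancy_function_def by simp
  qed
  have "discrepancy_function s X x N = discrepancy_function s X (restrict x {..<s}) N"
    by (simp add: discrepancy_function_def)
  moreover have "restrict x {..<s} \<in> {..<s} \<rightarrow>\<^sub>E {0..1}" using x by auto
  ultimately show ?thesis
    unfolding star_discrepancy_def using cSUP_upper[OF _ bdd] by metis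
qed

section \<open>Real numbers given by q-adic digits\<close>

lemma qadic_tail_sums:
  assumes "q \<ge> 2"
  shows "(\<lambda>i. if i < d then 0 else (real q - 1) / real q ^ Suc i) sums (1 / real q ^ d)"
proof -
  \<comment> \<open>The remainder q^-i, frozen at q^-d for i < d. Its differences vanish before
    place \<open>d\<close> and are (q - 1) / q^(i+1) afterwards, so one telescoping series covers
    both cases.\<close>
  let ?f = "\<lambda>i. 1 / real q ^ max i d"
  have "(\<lambda>i. (1 / real q) ^ i) \<longlonglongrightarrow> 0" using assms by (intro LIMSEQ_power_zero) auto
  then have "?f \<longlonglongrightarrow> 0"
    by (rule Lim_transform_eventually)
       (use eventually_ge_at_top[of d] in eventually_elim, simp add: power_one_over)
  from telescope_sums'[OF this]
  have "(\<lambda>i. ?f i - ?f (Suc i)) sums (1 / real q ^ d)" by simp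
  moreover have "?f i - ?f (Suc i) = (if i < d then 0 else (real q - 1) / real q ^ Suc i)" for i
    using assms by (auto simp: max_def field_simps)
  ultimately show ?thesis by simp
qed

lemma summable_qadic:
  assumes "q \<ge> 2" "\<And>i. y i < q"
  shows "summable (\<lambda>i. real (y i) / real q ^ Suc i)"
proof (rule summable_comparison_test')
  show "summable (\<lambda>i. if i < 0 then 0 else (real q - 1) / real q ^ Suc i)"
    using qadic_tail_sums[OF assms(1), of 0] by (rule sums_summable)
  show "norm (real (y i) / real q ^ Suc i) \<le> (if i < 0 then 0 else (real q - 1) / real q ^ Suc i)" for i
    using assms(2)[of i] by (auto intro!: divide_right_mono)
qed

lemma qadic_term_le:
  assumes "q \<ge> 2" "\<And>i. y i < q"
  shows "real (y i) / real q ^ Suc i \<le> (\<Sum>i. real (y i) / real q ^ Suc i)"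
  using sum_le_suminf[OF summable_qadic[OF assms], of "{i}"] by simp

lemma qadic_digits_eq_0:
  assumes q: "q \<ge> 2" and y: "\<And>i. y i < q"
    and less: "(\<Sum>i. real (y i) / real q ^ Suc i) < 1 / real q ^ d" and i: "i < d"
  shows "y i = 0"
proof (rule ccontr)
  assume "y i \<noteq> 0"
  have "1 / real q ^ d \<le> 1 / real q ^ Suc i"
    using i q by (intro divide_left_mono power_increasing) auto
  also have "\<dots> \<le> real (y i) / real q ^ Suc i"
    using \<open>y i \<noteq> 0\<close> by (intro divide_right_mono) auto
  also have "\<dots> \<le> (\<Sum>i. real (y i) / real q ^ Suc i)"
    by (intro qadic_term_le q y)
  finally show False using less by simp
qed

text \<open>The largest possible tail, with all digits from place \<open>d\<close> on equal to
  \<open>q - 1\<close>, sums to exactly q^-d. The bound is thus not strict, which is why the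
  forbidden box will start at 3/2 times q^-d instead of at q^-d.\<close>

lemma qadic_le:
  assumes q: "q \<ge> 2" and y: "\<And>i. y i < q" and 0: "\<And>i. i < d \<Longrightarrow> y i = 0"
  shows "(\<Sum>i. real (y i) / real q ^ Suc i) \<le> 1 / real q ^ d"
proof -
  have "real (y i) / real q ^ Suc i \<le> (if i < d then 0 else (real q - 1) / real q ^ Suc i)" for i
    using y[of i] 0[of i] by (auto intro!: divide_right_mono)
  then have "(\<Sum>i. real (y i) / real q ^ Suc i) \<le> (\<Sum>i. if i < d then 0 else (real q - 1) / real q ^ Suc i)"
    using sums_summable[OF qadic_tail_sums[OF q]] by (intro suminf_le summable_qadic q y) auto
  also have "\<dots> = 1 / real q ^ d" using qadic_tail_sums[OF q] by (rule sums_unique[symmetric])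
  finally show ?thesis .
qed

text \<open>After interchanging the sums, the form applied to the output digits is a combination of
  its values on the columns, weighted by the digits of \<open>n\<close>; since
  \<open>n < q ^ L\<close>, only the first \<open>L\<close> columns receive a nonzero
  weight.\<close>

lemma vanishing_output_digits:
  assumes q: "q \<ge> 2" and C: "C \<in> vanishing q s L k" and n: "n < q ^ L"
  shows "lin_form q k (\<lambda>(j, i). output_digit q (C j) n i) = 0"
proof -
  let ?S = "{p. k p \<noteq> 0}"
  have out: "output_digit q A n i = (\<Sum>r<L. A i r * qadic_digit q n r) mod q" for A i
  proof -
    have "qadic_digit q n r = 0" if "r \<ge> L" for r
    proof -
      have "q ^ L \<le> q ^ r" using q that by (intro power_increasing) auto
      then show ?thesis using n by (simp add: qadic_digit_def)
    qed
    then have "{r. qadic_digit q n r \<noteq> 0} \<subseteq> {..<L}"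
      by (metis (mono_tags) lessThan_iff mem_Collect_eq not_less subsetI)
    then show ?thesis
      unfolding output_digit_def by (subst sum.mono_neutral_left[of "{..<L}"]) auto
  qed
  have col: "q dvd (\<Sum>p\<in>?S. k p * C (fst p) (snd p) r)" if "r < L" for r
    using C that by (simp add: vanishing_def lin_form_def case_prod_unfold mod_eq_0_iff_dvd)
  have "(\<Sum>p\<in>?S. k p * (\<Sum>r<L. C (fst p) (snd p) r * qadic_digit q n r))
      = (\<Sum>r<L. (\<Sum>p\<in>?S. k p * C (fst p) (snd p) r) * qadic_digit q n r)"
    unfolding sum_distrib_left sum_distrib_right by (subst sum.swap) (simp add: mult.assoc)
  moreover have "q dvd (\<Sum>r<L. (\<Sum>p\<in>?S. k p * C (fst p) (snd p) r) * qadic_digit q n r)"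
  proof (rule dvd_sum)
    fix r assume "r \<in> {..<L}"
    then show "q dvd (\<Sum>p\<in>?S. k p * C (fst p) (snd p) r) * qadic_digit q n r"
      using col[of r] by (simp only: lessThan_iff dvd_mult2)
  qed
  ultimately have "q dvd (\<Sum>p\<in>?S. k p * (\<Sum>r<L. C (fst p) (snd p) r * qadic_digit q n r))"
    by (simp only:)
  then have "(\<Sum>p\<in>?S. (k p * (\<Sum>r<L. C (fst p) (snd p) r * qadic_digit q n r)) mod q) mod q = 0"
    by (simp add: mod_sum_eq mod_eq_0_iff_dvd)
  then have "(\<Sum>p\<in>?S. (k p * ((\<Sum>r<L. C (fst p) (snd p) r * qadic_digit q n r) mod q)) mod q) mod q = 0"
    by (simp only: mod_mult_right_eq)
  then show ?thesis
    by (simp add: lin_form_def case_prod_unfold out mod_sum_eq)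
qed

text \<open>The vanishing linear form forbids the digit pattern that is 1 at position \<open>(0, d 0 - 1)\<close> and 0
  elsewhere, so a box of volume comparable to \<open>q ^ - (\<Sum>j<s. d j)\<close> contains none of the first \<open>q ^ L\<close> points.\<close>

lemma star_discrepancy_ge_if_vanishing:
  assumes q: "q \<ge> 2" and s: "s \<ge> 1" and C: "C \<in> vanishing q s L k"
    and k: "{p. k p \<noteq> 0} \<subseteq> (SIGMA j:{..<s}. {..<d j})" and d0: "d 0 \<ge> 1" and lead: "k (0, d 0 - 1) = 1"
  shows "star_discrepancy s (digital_sequence q C) (q ^ L) \<ge> real q ^ L / (4 * real q ^ (\<Sum>j<s. d j))"
proof -
  let ?X = "digital_sequence q C"
  \<comment> \<open>Used with \<open>c = 2\<close> and \<open>c = 3 / 2\<close>: these two boxes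
    differ by a slab in coordinate 0 that stays away from the origin.\<close>
  define box where "box c j = (if j = 0 then c else 1) / real q ^ d j" for c :: real and j
  have box_prod: "(\<Prod>j<s. box c j) = c / real q ^ (\<Sum>j<s. d j)" for c
  proof -
    have "(\<Prod>j<s. box c j) = (\<Prod>j<s. if j = 0 then c else 1) / (\<Prod>j<s. real q ^ d j)"
      unfolding box_def by (rule prod_dividef)
    then show ?thesis using s by (simp add: power_sum)
  qed
  \<comment> \<open>In the slab the first coordinate, in units of q^-(d 0), is at least 3/2 and
    below 2. Being below 2 \<le> q forces zeros before place \<open>d 0 - 1\<close> and a digit at
    most 1 there; exceeding 1 excludes the digit 0. As the relevant digits of the other coordinates
    are 0, the form would take the value of its leading coefficient, which is 1.\<close>
  have empty: "?X n 0 < (3 / 2) / real q ^ d 0"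
    if n: "n < q ^ L" and X: "\<And>j. j < s \<Longrightarrow> ?X n j < box 2 j" for n
  proof (rule ccontr)
    define y where "y j i = output_digit q (C j) n i" for j i
    assume ge: "\<not> ?X n 0 < (3 / 2) / real q ^ d 0"
    have yq: "y j i < q" for j i using q by (simp add: y_def output_digit_def)
    have Xy: "?X n j = (\<Sum>i. real (y j i) / real q ^ Suc i)" for j
      by (simp add: digital_sequence_def y_def)
    have y0: "y j i = 0" if "0 < j" "j < s" "i < d j" for j i
      using X[of j] that unfolding Xy by (intro qadic_digits_eq_0[OF q yq]) (auto simp: box_def)
    obtain e where e: "d 0 = Suc e" using d0 by (cases "d 0") auto
    have "?X n 0 < 2 / real q ^ d 0" using X[of 0] s by (simp add: box_def)
    also have "\<dots> \<le> real q / real q ^ d 0" using q by (intro divide_right_mono) auto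
    also have "\<dots> = 1 / real q ^ e" using q by (simp add: e)
    finally have y00: "y 0 i = 0" if "i < e" for i
      using that unfolding Xy by (intro qadic_digits_eq_0[OF q yq])
    have "y 0 e \<noteq> 0"
    proof
      assume "y 0 e = 0"
      then have "y 0 i = 0" if "i < d 0" for i using y00 that by (auto simp: e less_Suc_eq)
      then have "?X n 0 \<le> 1 / real q ^ d 0" unfolding Xy by (intro qadic_le q yq)
      also have "\<dots> < (3 / 2) / real q ^ d 0" using q by (intro divide_strict_right_mono) auto
      finally show False using ge by simp
    qed
    moreover have "real (y 0 e) / real q ^ d 0 < 2 / real q ^ d 0"
      using qadic_term_le[where y = "y 0" and i = e, OF q yq] \<open>?X n 0 < 2 / real q ^ d 0\<close>
      unfolding Xy e by (rule le_less_trans)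
    then have "y 0 e < 2" using q by (simp add: divide_less_cancel)
    ultimately have y1: "y 0 e = 1" by simp
    have fin: "finite {p. k p \<noteq> 0}" using k by (rule finite_subset) auto
    have "(\<Sum>p | k p \<noteq> 0. k p * (case p of (j, i) \<Rightarrow> y j i)) = (\<Sum>p\<in>{(0, e)}. k p * (case p of (j, i) \<Rightarrow> y j i))"
    proof (rule sum.mono_neutral_right[OF fin])
      show "{(0, e)} \<subseteq> {p. k p \<noteq> 0}" using lead by (simp add: e)
      show "\<forall>p\<in>{p. k p \<noteq> 0} - {(0, e)}. k p * (case p of (j, i) \<Rightarrow> y j i) = 0"
      proof
        fix p assume p: "p \<in> {p. k p \<noteq> 0} - {(0, e)}"
        obtain j i where ji: "p = (j, i)" by (cases p)
        then have "j < s" "i < d j" "(j, i) \<noteq> (0, e)" using p k by auto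
        then have "y j i = 0" using y0[of j i] y00[of i] by (cases "j = 0") (auto simp: e)
        then show "k p * (case p of (j, i) \<Rightarrow> y j i) = 0" by (simp add: ji)
      qed
    qed
    also have "\<dots> = 1" using lead y1 by (simp add: e)
    finally have "lin_form q k (\<lambda>(j, i). y j i) = 1" using q by (simp add: lin_form_def)
    then show False using vanishing_output_digits[OF q C n] by (simp add: y_def)
  qed
  have box_mono: "box (3 / 2) j \<le> box 2 j" for j
    unfolding box_def by (intro divide_right_mono) auto
  have "{n. n < q ^ L \<and> (\<forall>j<s. ?X n j \<in> {0..<box 2 j})} = {n. n < q ^ L \<and> (\<forall>j<s. ?X n j \<in> {0..<box (3 / 2) j})}"
  proof (intro equalityI subsetI)
    fix n assume n: "n \<in> {n. n < q ^ L \<and> (\<forall>j<s. ?X n j \<in> {0..<box 2 j})}"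
    then have "?X n 0 < (3 / 2) / real q ^ d 0" by (intro empty) auto
    with n show "n \<in> {n. n < q ^ L \<and> (\<forall>j<s. ?X n j \<in> {0..<box (3 / 2) j})}"
      by (auto simp: box_def)
  next
    fix n assume "n \<in> {n. n < q ^ L \<and> (\<forall>j<s. ?X n j \<in> {0..<box (3 / 2) j})}"
    then show "n \<in> {n. n < q ^ L \<and> (\<forall>j<s. ?X n j \<in> {0..<box 2 j})}"
      using box_mono by (auto intro: less_le_trans)
  qed
  \<comment> \<open>Both boxes hold the same points, so only their volumes differ, by one half of
    q^-(sum of all \<open>d j\<close>). One of the two discrepancies is at least half of the
    resulting gap, whence the factor 4.\<close>
  then have "discrepancy_function s ?X (box (3 / 2)) (q ^ L) - discrepancy_function s ?X (box 2) (q ^ L)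
      = real q ^ L / (2 * real q ^ (\<Sum>j<s. d j))"
    unfolding discrepancy_function_def box_prod using q by (simp add: field_simps)
  moreover have "\<bar>discrepancy_function s ?X (box c) (q ^ L)\<bar> \<le> star_discrepancy s ?X (q ^ L)"
    if c: "0 \<le> c" "c \<le> 2" for c
  proof (rule discrepancy_le_star_discrepancy)
    fix j
    have "box c j \<le> 1"
    proof (cases "j = 0")
      case True
      have "c \<le> real q ^ 1" using c q by simp
      also have "\<dots> \<le> real q ^ d 0" using d0 q by (intro power_increasing) auto
      finally show ?thesis using True q by (simp add: box_def)
    next
      case False
      have "1 \<le> real q ^ d j" using q by (intro one_le_power) auto
      then have "1 / real q ^ d j \<le> 1 / 1" using q by (intro divide_left_mono) auto
      then show ?thesis using False by (simp add: box_def)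
    qed
    then show "0 \<le> box c j \<and> box c j \<le> 1" using c by (simp add: box_def)
  qed
  from this[of 2] this[of "3 / 2"]
  have "\<bar>discrepancy_function s ?X (box 2) (q ^ L)\<bar> \<le> star_discrepancy s ?X (q ^ L)"
    "\<bar>discrepancy_function s ?X (box (3 / 2)) (q ^ L)\<bar> \<le> star_discrepancy s ?X (q ^ L)" by auto
  ultimately show ?thesis by simp
qed

section \<open>Counting the linear forms\<close>

definition compositions :: "nat \<Rightarrow> nat \<Rightarrow> (nat \<Rightarrow> nat) set" where
  "compositions s n = {d \<in> {..<s} \<rightarrow>\<^sub>E {1..}. (\<Sum>j<s. d j) = n}"

text \<open>Each block resembles a monic polynomial of degree \<open>d j - 1\<close>. The default 0
  turns vectors living on different regions into total functions that can be compared
  directly.\<close>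

definition monic_coeffs :: "nat \<Rightarrow> nat \<Rightarrow> (nat \<Rightarrow> nat) \<Rightarrow> (nat \<times> nat \<Rightarrow> nat) set" where
  "monic_coeffs q s d = PiE_dflt (SIGMA j:{..<s}. {..<d j}) 0 (\<lambda>(j, i). if Suc i = d j then {1} else {..<q})"

lemma finite_compositions: "finite (compositions s n)"
proof (rule finite_subset)
  show "compositions s n \<subseteq> {..<s} \<rightarrow>\<^sub>E {..n}"
  proof
    fix d assume d: "d \<in> compositions s n"
    then have "d j \<le> n" if "j < s" for j
      using that member_le_sum[of j "{..<s}" d] by (simp add: compositions_def)
    then show "d \<in> {..<s} \<rightarrow>\<^sub>E {..n}" using d by (auto simp: compositions_def PiE_iff)
  qed
qed (auto intro: finite_PiE)

text \<open>All parts except the one at 0 can be chosen freely from 1 to \<open>m\<close>; the part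
  at 0 absorbs the remainder, and the total \<open>s * m\<close> leaves at least \<open>m\<close>
  for it.\<close>

lemma card_compositions_ge:
  assumes s: "s \<ge> 1" and m: "m \<ge> 1"
  shows "m ^ (s - 1) \<le> card (compositions s (s * m))"
proof -
  define g where "g e = (\<lambda>j\<in>{..<s}. if j = 0 then s * m - (\<Sum>i\<in>{1..<s}. e i) else e j)" for e :: "nat \<Rightarrow> nat"
  let ?E = "{1..<s} \<rightarrow>\<^sub>E {1..m}"
  have split: "{..<s} = insert 0 {1..<s}" using s by auto
  have inj: "inj_on g ?E"
  proof (rule inj_onI)
    fix e e' assume e: "e \<in> ?E" "e' \<in> ?E" and eq: "g e = g e'"
    show "e = e'"
    proof (rule PiE_ext[OF e])
      fix i assume "i \<in> {1..<s}"
      then show "e i = e' i" using fun_cong[OF eq, of i] by (simp add: g_def)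
    qed
  qed
  have into: "g ` ?E \<subseteq> compositions s (s * m)"
  proof (intro image_subsetI)
    fix e assume e: "e \<in> ?E"
    have "(\<Sum>i\<in>{1..<s}. e i) \<le> (\<Sum>i\<in>{1..<s}. m)" using e by (intro sum_mono) (auto simp: PiE_iff)
    also have "\<dots> + m = s * m" using s by (cases s) auto
    finally have le: "(\<Sum>i\<in>{1..<s}. e i) + m \<le> s * m" by simp
    have "(\<Sum>j<s. g e j) = g e 0 + (\<Sum>j\<in>{1..<s}. g e j)" unfolding split by (subst sum.insert) auto
    also have "(\<Sum>j\<in>{1..<s}. g e j) = (\<Sum>j\<in>{1..<s}. e j)" by (intro sum.cong) (auto simp: g_def)
    finally have "(\<Sum>j<s. g e j) = s * m" using le s by (simp add: g_def)
    then show "g e \<in> compositions s (s * m)"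
      using le m e by (auto simp: compositions_def g_def PiE_iff)
  qed
  have "m ^ (s - 1) = card ?E" by (simp add: card_PiE)
  also have "\<dots> \<le> card (compositions s (s * m))" using inj into finite_compositions by (rule card_inj_on_le)
  finally show ?thesis .
qed

lemma monic_coeffsD:
  assumes "k \<in> monic_coeffs q s d"
  shows monic_coeffs_support: "{p. k p \<noteq> 0} \<subseteq> (SIGMA j:{..<s}. {..<d j})"
    and monic_coeffs_lead: "\<And>j. j < s \<Longrightarrow> d j \<ge> 1 \<Longrightarrow> k (j, d j - 1) = 1"
    and monic_coeffs_less: "\<And>p. q \<ge> 2 \<Longrightarrow> k p < q"
proof -
  have k: "p \<in> (SIGMA j:{..<s}. {..<d j}) \<Longrightarrow> k p \<in> (case p of (j, i) \<Rightarrow> if Suc i = d j then {1} else {..<q})"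
    "p \<notin> (SIGMA j:{..<s}. {..<d j}) \<Longrightarrow> k p = 0" for p
    using assms unfolding monic_coeffs_def PiE_dflt_def by blast+
  show "{p. k p \<noteq> 0} \<subseteq> (SIGMA j:{..<s}. {..<d j})"
  proof
    fix p assume "p \<in> {p. k p \<noteq> 0}"
    then show "p \<in> (SIGMA j:{..<s}. {..<d j})" using k(2)[of p] by (metis mem_Collect_eq)
  qed
  show "k (j, d j - 1) = 1" if "j < s" "d j \<ge> 1" for j using k(1)[of "(j, d j - 1)"] that by simp
  show "k p < q" if "q \<ge> 2" for p
    using k[of p] that by (cases "p \<in> (SIGMA j:{..<s}. {..<d j})") (auto split: if_splits)
qed

lemma finite_monic_coeffs: "finite (monic_coeffs q s d)"
  unfolding monic_coeffs_def by (intro finite_PiE_dflt) auto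

text \<open>One coefficient in each of the \<open>s\<close> blocks is prescribed, at the cost of a
  factor \<open>q\<close> per block. That factor stands on the left so that no exponent
  \<open>n - s\<close> is needed.\<close>

lemma card_monic_coeffs:
  assumes "d \<in> compositions s n"
  shows "card (monic_coeffs q s d) * q ^ s = q ^ n"
proof -
  have d: "d j \<ge> 1" if "j < s" for j using assms that by (auto simp: compositions_def PiE_iff)
  have row: "(\<Prod>i<d j. card (if Suc i = d j then {1} else {..<q})) * q = q ^ d j" if j: "j < s" for j
  proof -
    obtain e where e: "d j = Suc e" using d[OF j] by (cases "d j") auto
    have "(\<Prod>i<e. card (if i = e then {1::nat} else {..<q})) = (\<Prod>i<e. q)" by (intro prod.cong) auto
    then show ?thesis by (simp add: e)
  qed
  have "card (monic_coeffs q s d) = (\<Prod>p\<in>(SIGMA j:{..<s}. {..<d j}). card (case p of (j, i) \<Rightarrow> if Suc i = d j then {1} else {..<q}))"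
    unfolding monic_coeffs_def by (subst card_PiE_dflt) auto
  also have "\<dots> = (\<Prod>(j, i)\<in>(SIGMA j:{..<s}. {..<d j}). card (if Suc i = d j then {1} else {..<q}))"
    by (intro prod.cong) auto
  also have "\<dots> = (\<Prod>j<s. \<Prod>i<d j. card (if Suc i = d j then {1} else {..<q}))"
    by (subst prod.Sigma) auto
  finally have "card (monic_coeffs q s d) * q ^ s = (\<Prod>j<s. (\<Prod>i<d j. card (if Suc i = d j then {1} else {..<q})) * q)"
    by (simp add: prod.distrib)
  also have "\<dots> = (\<Prod>j<s. q ^ d j)" using row by (intro prod.cong) auto
  also have "\<dots> = q ^ n" using assms by (simp add: power_sum[symmetric] compositions_def)
  finally show ?thesis .
qed

text \<open>The last nonzero coefficient of block \<open>j\<close> sits at \<open>d j - 1\<close>,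
  so the vector remembers its degrees. Hence the families for different compositions are disjoint,
  also across different totals.\<close>

lemma monic_coeffs_degree_unique:
  assumes d: "d \<in> compositions s n" "d' \<in> compositions s n'"
    and k: "k \<in> monic_coeffs q s d" "k \<in> monic_coeffs q s d'"
  shows "d = d'"
proof (rule PiE_ext)
  show "d \<in> {..<s} \<rightarrow>\<^sub>E {1..}" "d' \<in> {..<s} \<rightarrow>\<^sub>E {1..}" using d by (auto simp: compositions_def)
  fix j assume j: "j \<in> {..<s}"
  then have ge: "d j \<ge> 1" "d' j \<ge> 1" using d by (auto simp: compositions_def PiE_iff)
  have "(j, d j - 1) \<in> {p. k p \<noteq> 0}" "(j, d' j - 1) \<in> {p. k p \<noteq> 0}"
    using monic_coeffs_lead[OF k(1)] monic_coeffs_lead[OF k(2)] j ge by auto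
  then have "d j - 1 < d' j" "d' j - 1 < d j"
    using monic_coeffs_support[OF k(1)] monic_coeffs_support[OF k(2)] by auto
  then show "d j = d' j" using ge by simp
qed

text \<open>The leading places in block 0 decide. If they differ, the minor at these two places is
  triangular with value 1. If they coincide, its minor with a place \<open>c\<close> where the
  vectors differ is \<open>k' c - k c\<close>, which is nonzero and smaller than \<open>q\<close> in
  absolute value.\<close>

lemma monic_coeffs_independent:
  assumes s: "s \<ge> 1" and q: "q \<ge> 2" and d: "d \<in> compositions s n" "d' \<in> compositions s n'"
    and k: "k \<in> monic_coeffs q s d" and k': "k' \<in> monic_coeffs q s d'" and ne: "k \<noteq> k'"
  shows "\<exists>a c. \<not> int q dvd int (k a) * int (k' c) - int (k c) * int (k' a)"
proof -
  have ge: "d 0 \<ge> 1" "d' 0 \<ge> 1" using d s by (auto simp: compositions_def PiE_iff)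
  note lead = monic_coeffs_lead[OF k, of 0] monic_coeffs_lead[OF k', of 0]
  have zero: "k (0, i) = 0" if "i \<ge> d 0" for i using monic_coeffs_support[OF k] that by force
  have zero': "k' (0, i) = 0" if "i \<ge> d' 0" for i using monic_coeffs_support[OF k'] that by force
  have q1: "\<not> int q dvd 1" using q by auto
  consider "d 0 < d' 0" | "d' 0 < d 0" | "d 0 = d' 0" by linarith
  then show ?thesis
  proof cases
    case 1
    then show ?thesis using q1 lead ge s zero[of "d' 0 - 1"]
      by (intro exI[of _ "(0, d 0 - 1)"] exI[of _ "(0, d' 0 - 1)"]) simp
  next
    case 2
    then show ?thesis using q1 lead ge s zero'[of "d 0 - 1"]
      by (intro exI[of _ "(0, d 0 - 1)"] exI[of _ "(0, d' 0 - 1)"]) simp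
  next
    case 3
    obtain c where c: "k c \<noteq> k' c" using ne by blast
    have "\<bar>int (k' c) - int (k c)\<bar> < int q"
      using monic_coeffs_less[OF k q, of c] monic_coeffs_less[OF k' q, of c] by linarith
    then have "\<not> int q dvd int (k' c) - int (k c)" using c dvd_imp_le_int[of "int (k' c) - int (k c)" "int q"] by auto
    then show ?thesis using lead ge s 3 by (intro exI[of _ "(0, d 0 - 1)"] exI[of _ c]) simp
  qed
qed

section \<open>Divergence of the sum of 1 / (m ln m) and the size of the exponent\<close>

lemma ln_ln_diff_le:
  fixes m :: nat
  assumes "m \<ge> 3"
  shows "ln (ln (real (Suc m))) - ln (ln (real m)) \<le> 1 / (real m * ln (real m))"
proof -
  have m: "ln (real m) > 0" "ln (real (Suc m)) > 0" using assms by auto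
  have "1 + 1 / real m = real (Suc m) / real m" using assms by (simp add: field_simps)
  then have "ln (real (Suc m)) - ln (real m) = ln (1 + 1 / real m)"
    using assms by (simp add: ln_div)
  also have "\<dots> \<le> 1 / real m" using assms by (intro ln_add_one_self_le_self) auto
  finally have d: "ln (real (Suc m)) - ln (real m) \<le> 1 / real m" .
  have "ln (ln (real (Suc m))) - ln (ln (real m)) = ln (ln (real (Suc m)) / ln (real m))"
    using m by (simp add: ln_div)
  also have "\<dots> \<le> ln (real (Suc m)) / ln (real m) - 1" using m by (intro ln_le_minus_one) auto
  also have "\<dots> = (ln (real (Suc m)) - ln (real m)) / ln (real m)" using m by (simp add: field_simps)
  also have "\<dots> \<le> (1 / real m) / ln (real m)" using d m by (intro divide_right_mono) auto
  finally show ?thesis by simp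
qed

text \<open>Telescoping the increments of ln ln replaces a comparison with the integral of 1 / (x ln
  x); as ln ln n is unbounded, the series diverges.\<close>

lemma ln_ln_le_sum:
  fixes n :: nat
  assumes "n \<ge> 3"
  shows "ln (ln (real n)) - ln (ln 3) \<le> (\<Sum>m\<in>{3..<n}. 1 / (real m * ln (real m)))"
  using assms
proof (induction n rule: dec_induct)
  case (step n)
  then show ?case using ln_ln_diff_le[of n] by simp
qed simp

lemma ln_ge_one: "m \<ge> 3 \<Longrightarrow> ln (real m) \<ge> 1"
  using exp_le by (subst ln_ge_iff) auto

text \<open>The exponent balances two needs: \<open>q ^ excess q s m\<close> is the size of the discrepancy gained, and
  \<open>1 / q ^ excess q s m\<close> is small enough to make the sum of the probabilities comparable to
  \<open>\<Sum>m. 1 / (m * ln m)\<close>.\<close>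

definition excess :: "nat \<Rightarrow> nat \<Rightarrow> nat \<Rightarrow> nat" where
  "excess q s m = nat \<lceil>log (real q) (real m ^ s * ln (real m))\<rceil>"

lemma excess_bounds:
  assumes q: "q \<ge> 2" and m: "m \<ge> 3"
  shows excess_ge: "real m ^ s * ln (real m) \<le> real q ^ excess q s m"
    and excess_le: "real q ^ excess q s m \<le> real q * (real m ^ s * ln (real m))"
proof -
  define z where "z = real m ^ s * ln (real m)"
  \<comment> \<open>From \<open>m \<ge> 3\<close> on, \<open>z\<close> is at least 1, so its
    logarithm is nonnegative and \<open>nat\<close> does not truncate; the ceiling then costs at
    most a factor \<open>q\<close>.\<close>
  have "1 * 1 \<le> z" unfolding z_def using ln_ge_one[OF m] m by (intro mult_mono one_le_power) auto
  then have z: "z \<ge> 1" by simp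
  have log: "log (real q) z \<ge> 0" using z q by simp
  define l where "l = excess q s m"
  have l: "log (real q) z \<le> real l" "real l \<le> log (real q) z + 1"
    using log unfolding l_def excess_def z_def[symmetric] by linarith+
  have "z = real q powr log (real q) z" using z q by simp
  also have "\<dots> \<le> real q powr real l" using l q by (intro powr_mono) auto
  finally show "real m ^ s * ln (real m) \<le> real q ^ excess q s m"
    using q by (simp add: powr_realpow z_def l_def)
  have "real q ^ l = real q powr real l" using q by (simp add: powr_realpow)
  also have "\<dots> \<le> real q powr (log (real q) z + 1)" using l q by (intro powr_mono) auto
  also have "\<dots> = real q * z" using z q by (simp add: powr_add)
  finally show "real q ^ excess q s m \<le> real q * (real m ^ s * ln (real m))" by (simp add: z_def l_def)
qed

text \<open>Let N = q^(s m + l) with l the excess. The upper bound on q^l gives l ln q \<le> (ln q +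
  s + 1) m, and adding s m ln q yields exactly K m as a bound for ln N. Since ln m \<ge> 1, also ln
  ln N \<le> (1 + ln K) ln m, and m^s ln m is what q^l was chosen to dominate.\<close>

lemma discrepancy_scale_le:
  fixes q s :: nat
  defines "K \<equiv> (real s + 1) * (ln (real q) + 1)"
  assumes q: "q \<ge> 2" and m: "m \<ge> 3"
  shows "ln (real (q ^ (s * m + excess q s m))) ^ s * ln (ln (real (q ^ (s * m + excess q s m))))
      \<le> K ^ s * (1 + ln K) * real q ^ excess q s m"
proof -
  let ?l = "excess q s m" and ?M = "real m"
  let ?x = "ln (real (q ^ (s * m + ?l)))"
  have lm: "ln ?M \<ge> 1" using m by (rule ln_ge_one)
  have lq: "ln (real q) > 0" using q by simp
  have K: "K \<ge> 1" unfolding K_def using mult_mono[of 1 "real s + 1" 1 "ln (real q) + 1"] lq by simp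
  have lnm: "ln ?M \<le> ?M" "ln (ln ?M) \<le> ?M" using m lm ln_le_minus_one[of ?M] ln_le_minus_one[of "ln ?M"] by auto
  have "real ?l * ln (real q) = ln (real q ^ ?l)" using q by (simp add: ln_realpow)
  also have "\<dots> \<le> ln (real q * (?M ^ s * ln ?M))"
    using excess_le[OF q m, of s] q m lm by (subst ln_le_cancel_iff) (auto intro!: mult_pos_pos)
  also have "\<dots> = ln (real q) + real s * ln ?M + ln (ln ?M)"
    using q m lm by (simp add: ln_mult ln_realpow)
  also have "\<dots> \<le> ln (real q) * ?M + real s * ?M + ?M"
    using lnm lq m by (intro add_mono mult_left_mono) (auto simp: mult_le_cancel_left1)
  finally have "real (s * m + ?l) * ln (real q) \<le> K * ?M"
    by (simp add: K_def algebra_simps)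
  then have x: "?x \<le> K * ?M" using q by (simp add: ln_realpow)
  show ?thesis
  proof (cases "s * m + ?l = 0")
    \<comment> \<open>Here N = 1, and the left side is 0 because of the default value
      \<open>ln 0 = 0\<close>.\<close>
    case True
    then have "?x = 0" by (simp only: power_0 of_nat_1 ln_one)
    moreover have "0 \<le> K ^ s * (1 + ln K) * real q ^ ?l" using K by simp
    ultimately show ?thesis by (simp only: ln_0 mult_zero_right)
  next
    case False
    then have "real (q ^ (s * m + ?l)) > 1" using q by (simp add: one_less_power)
    then have x0: "?x > 0" by (rule ln_gt_zero)
    have "ln ?x \<le> ln (K * ?M)" using x x0 by (intro ln_mono) auto
    also have "\<dots> = ln K + ln ?M" using K m by (simp add: ln_mult)
    also have "\<dots> \<le> ln K * ln ?M + ln ?M" using K lm by (simp add: mult_le_cancel_left1)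
    finally have lx: "ln ?x \<le> (1 + ln K) * ln ?M" by (simp add: algebra_simps)
    have "?x ^ s * ln ?x \<le> ?x ^ s * ((1 + ln K) * ln ?M)" using lx x0 by (intro mult_left_mono) auto
    also have "\<dots> \<le> (K * ?M) ^ s * ((1 + ln K) * ln ?M)"
      using x x0 K lm by (intro mult_right_mono power_mono) auto
    also have "\<dots> = K ^ s * (1 + ln K) * (?M ^ s * ln ?M)" by (simp add: power_mult_distrib)
    also have "\<dots> \<le> K ^ s * (1 + ln K) * real q ^ ?l"
      using excess_ge[OF q m, of s] K by (intro mult_left_mono) auto
    finally show ?thesis .
  qed
qed

section \<open>Infinitely many vanishing linear forms\<close>

definition coeff_index :: "nat \<Rightarrow> nat \<Rightarrow> nat \<Rightarrow> ((nat \<Rightarrow> nat) \<times> (nat \<times> nat \<Rightarrow> nat)) set" where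
  "coeff_index q s m = (SIGMA d:compositions s (s * m). monic_coeffs q s d)"

definition coeff_event :: "nat \<Rightarrow> nat \<Rightarrow> nat \<times> (nat \<Rightarrow> nat) \<times> (nat \<times> nat \<Rightarrow> nat) \<Rightarrow> (nat \<Rightarrow> nat \<Rightarrow> nat \<Rightarrow> nat) set" where
  "coeff_event q s = (\<lambda>(m, d, k). vanishing q s (s * m + excess q s m) k)"

lemma finite_coeff_index: "finite (coeff_index q s m)"
  unfolding coeff_index_def by (intro finite_SigmaI finite_compositions finite_monic_coeffs)

lemma card_coeff_index_ge:
  assumes s: "s \<ge> 1" and m: "m \<ge> 1"
  shows "m ^ (s - 1) * q ^ (s * m) \<le> card (coeff_index q s m) * q ^ s"
proof -
  have "card (coeff_index q s m) * q ^ s = (\<Sum>d\<in>compositions s (s * m). card (monic_coeffs q s d) * q ^ s)"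
    unfolding coeff_index_def
    by (subst card_SigmaI) (auto simp: finite_compositions finite_monic_coeffs sum_distrib_right)
  also have "\<dots> = card (compositions s (s * m)) * q ^ (s * m)"
    by (simp add: card_monic_coeffs)
  finally show ?thesis using card_compositions_ge[OF s m] by simp
qed

lemma monic_coeffs_nonzero:
  assumes "s \<ge> 1" "q \<ge> 2" "d \<in> compositions s n" "k \<in> monic_coeffs q s d"
  shows "\<exists>a. \<not> q dvd k a"
proof -
  have "d 0 \<ge> 1" using assms by (auto simp: compositions_def PiE_iff)
  then have "k (0, d 0 - 1) = 1" using monic_coeffs_lead[OF assms(4)] assms(1) by simp
  then show ?thesis using assms(2) by (intro exI[of _ "(0, d 0 - 1)"]) simp
qed

lemma monic_coeffs_finite_support:
  assumes "k \<in> monic_coeffs q s d"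
  shows "finite {p. k p \<noteq> 0}" "{p. k p \<noteq> 0} \<subseteq> {..<s} \<times> UNIV"
proof -
  note sub = monic_coeffs_support[OF assms]
  show "finite {p. k p \<noteq> 0}" by (rule finite_subset[OF sub]) auto
  show "{p. k p \<noteq> 0} \<subseteq> {..<s} \<times> UNIV" using sub by auto
qed

lemma coeff_event_prob:
  assumes q: "prime q" and s: "s \<ge> 1" and x: "x \<in> coeff_index q s m"
  shows "coeff_event q s (m, x) \<in> sets (matrix_tuple_measure q s)"
    and "measure (matrix_tuple_measure q s) (coeff_event q s (m, x)) = 1 / real q ^ (s * m + excess q s m)"
proof -
  have q2: "q \<ge> 2" using q by (rule prime_ge_2_nat)
  obtain d k where dk: "x = (d, k)" "d \<in> compositions s (s * m)" "k \<in> monic_coeffs q s d"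
    using x by (auto simp: coeff_index_def)
  obtain a where a: "\<not> q dvd k a" using monic_coeffs_nonzero[OF s q2 dk(2,3)] by blast
  note supp = monic_coeffs_finite_support[OF dk(3)]
  show "coeff_event q s (m, x) \<in> sets (matrix_tuple_measure q s)"
    unfolding coeff_event_def dk(1) using sets_vanishing[OF q supp a] by simp
  show "measure (matrix_tuple_measure q s) (coeff_event q s (m, x)) = 1 / real q ^ (s * m + excess q s m)"
    unfolding coeff_event_def dk(1) using measure_vanishing[OF q supp a] by simp
qed

text \<open>An index can be recovered from its coefficient vector: \<open>k\<close> determines
  \<open>d\<close>, the sum of \<open>d\<close> is \<open>s * m\<close>, and
  \<open>s \<ge> 1\<close> gives \<open>m\<close>. So different indices, even at different levels,
  have different vectors, and these are independent modulo \<open>q\<close>.\<close>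

lemma coeff_event_pairwise_indep:
  assumes q: "prime q" and s: "s \<ge> 1" and x: "x \<in> coeff_index q s m" and y: "y \<in> coeff_index q s n"
    and ne: "(m, x) \<noteq> (n, y)"
  shows "measure (matrix_tuple_measure q s) (coeff_event q s (m, x) \<inter> coeff_event q s (n, y))
      = measure (matrix_tuple_measure q s) (coeff_event q s (m, x)) * measure (matrix_tuple_measure q s) (coeff_event q s (n, y))"
proof -
  have q2: "q \<ge> 2" using q by (rule prime_ge_2_nat)
  obtain d k where dk: "x = (d, k)" "d \<in> compositions s (s * m)" "k \<in> monic_coeffs q s d"
    using x by (auto simp: coeff_index_def)
  obtain d' k' where dk': "y = (d', k')" "d' \<in> compositions s (s * n)" "k' \<in> monic_coeffs q s d'"
    using y by (auto simp: coeff_index_def)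
  have "k \<noteq> k'"
  proof
    assume k: "k = k'"
    then have d: "d = d'" using monic_coeffs_degree_unique[OF dk(2) dk'(2)] dk dk' by simp
    then have "s * m = s * n" using dk(2) dk'(2) by (auto simp: compositions_def)
    then show False using ne k d s dk(1) dk'(1) by auto
  qed
  then obtain a c where det: "\<not> int q dvd int (k a) * int (k' c) - int (k c) * int (k' a)"
    using monic_coeffs_independent[OF s q2 dk(2) dk'(2) dk(3) dk'(3)] by blast
  show ?thesis
    unfolding coeff_event_prob(2)[OF q s x] coeff_event_prob(2)[OF q s y]
    unfolding coeff_event_def dk(1) dk'(1)
    using measure_vanishing_Int[OF q monic_coeffs_finite_support[OF dk(3)] monic_coeffs_finite_support[OF dk'(3)] det]
    by simp
qed

text \<open>At least m^(s-1) q^(s m) / q^s vectors contribute q^-(s m) / q^l each, where q^l \<le> q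
  m^s ln m. In the constant q^(s+1), the factor q^s pays for the prescribed leading coefficients and
  one \<open>q\<close> for rounding the exponent.\<close>

lemma sum_coeff_event_ge:
  assumes q: "prime q" and s: "s \<ge> 1" and m: "m \<ge> 3"
  shows "1 / real q ^ (s + 1) * (1 / (real m * ln (real m)))
      \<le> (\<Sum>x\<in>coeff_index q s m. measure (matrix_tuple_measure q s) (coeff_event q s (m, x)))"
proof -
  have q2: "q \<ge> 2" using q by (rule prime_ge_2_nat)
  have lm: "ln (real m) > 0" using ln_ge_one[OF m] by simp
  let ?l = "excess q s m" and ?c = "real (card (coeff_index q s m))"
  have "real m ^ (s - 1) * real q ^ (s * m) \<le> ?c * real q ^ s"
    using card_coeff_index_ge[of s m q] s m by (simp only: of_nat_mult[symmetric] of_nat_power[symmetric] of_nat_le_iff)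
  then have c: "real m ^ (s - 1) \<le> ?c * real q ^ s / real q ^ (s * m)" using q2 by (simp add: field_simps)
  have ms: "real m ^ s = real m * real m ^ (s - 1)" using s by (cases s) auto
  have "1 / real q ^ (s + 1) * (1 / (real m * ln (real m)))
      = real m ^ (s - 1) / real q ^ s / (real q * (real m ^ s * ln (real m)))"
    using m lm q2 by (simp add: ms field_simps)
  also have "\<dots> \<le> real m ^ (s - 1) / real q ^ s / real q ^ ?l"
    using excess_le[OF q2 m, of s] q2 lm m by (intro divide_left_mono) auto
  also have "\<dots> \<le> ?c * real q ^ s / real q ^ (s * m) / real q ^ s / real q ^ ?l"
    using c q2 by (intro divide_right_mono) auto
  also have "\<dots> = ?c * (1 / real q ^ (s * m + ?l))" using q2 by (simp add: power_add field_simps)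
  also have "\<dots> = (\<Sum>x\<in>coeff_index q s m. measure (matrix_tuple_measure q s) (coeff_event q s (m, x)))"
    using coeff_event_prob(2)[OF q s] by simp
  finally show ?thesis .
qed

text \<open>The levels \<open>m\<close> are disjoint parts of the index set, so their lower bounds
  add up, and a finite total would bound ln ln n for all n.\<close>

lemma coeff_event_not_summable:
  assumes q: "prime q" and s: "s \<ge> 1"
  shows "\<not> (\<lambda>\<kappa>. measure (matrix_tuple_measure q s) (coeff_event q s \<kappa>)) summable_on (SIGMA m:{3..}. coeff_index q s m)"
    (is "\<not> ?P summable_on ?K")
proof
  assume sm: "?P summable_on ?K"
  have q0: "q > 0" using q by (rule prime_gt_0_nat)
  have bound: "1 / real q ^ (s + 1) * (ln (ln (real n)) - ln (ln 3)) \<le> infsum ?P ?K" if n: "n \<ge> 3" for n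
  proof -
    have "1 / real q ^ (s + 1) * (ln (ln (real n)) - ln (ln 3))
        \<le> 1 / real q ^ (s + 1) * (\<Sum>m\<in>{3..<n}. 1 / (real m * ln (real m)))"
      using ln_ln_le_sum[OF n] by (intro mult_left_mono) auto
    also have "\<dots> \<le> (\<Sum>m\<in>{3..<n}. \<Sum>x\<in>coeff_index q s m. ?P (m, x))"
      unfolding sum_distrib_left using sum_coeff_event_ge[OF q s] by (intro sum_mono) auto
    also have "\<dots> = sum ?P (SIGMA m:{3..<n}. coeff_index q s m)"
      by (subst sum.Sigma) (auto simp: finite_coeff_index)
    also have "\<dots> \<le> infsum ?P ?K"
      using sm by (intro finite_sum_le_infsum) (auto simp: finite_coeff_index)
    finally show ?thesis .
  qed
  have "filterlim (\<lambda>n. ln (ln (real n))) at_top sequentially"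
    by (intro filterlim_compose[OF ln_at_top] filterlim_real_sequentially)
  then have "eventually (\<lambda>n. ln (ln (real n)) > infsum ?P ?K * real q ^ (s + 1) + ln (ln 3)) sequentially"
    by (simp add: filterlim_at_top_dense)
  then have "eventually (\<lambda>n. n \<ge> 3 \<and> ln (ln (real n)) > infsum ?P ?K * real q ^ (s + 1) + ln (ln 3)) sequentially"
    using eventually_ge_at_top[of 3] by (rule eventually_conj[rotated])
  then obtain n where n: "n \<ge> 3" "ln (ln (real n)) > infsum ?P ?K * real q ^ (s + 1) + ln (ln 3)"
    by (auto simp: eventually_sequentially)
  then show False using bound[OF n(1)] q0 by (simp add: field_simps)
qed

lemma AE_infinite_coeff_events:
  assumes q: "prime q" and s: "s \<ge> 1"
  shows "AE C in matrix_tuple_measure q s. infinite {\<kappa> \<in> (SIGMA m:{3..}. coeff_index q s m). C \<in> coeff_event q s \<kappa>}"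
proof -
  interpret prob_space "matrix_tuple_measure q s"
    using q by (intro prob_space_matrix_tuple_measure prime_gt_0_nat)
  show ?thesis
  proof (rule borel_cantelli_pairwise_AE)
    show "countable (SIGMA m:{3..}. coeff_index q s m)"
      by (intro countable_SIGMA countableI_type countable_finite finite_coeff_index)
    show "coeff_event q s \<kappa> \<in> events" if "\<kappa> \<in> (SIGMA m:{3..}. coeff_index q s m)" for \<kappa>
      using that coeff_event_prob(1)[OF q s] by auto
    show "prob (coeff_event q s \<kappa> \<inter> coeff_event q s \<nu>) = prob (coeff_event q s \<kappa>) * prob (coeff_event q s \<nu>)"
      if "\<kappa> \<in> (SIGMA m:{3..}. coeff_index q s m)" "\<nu> \<in> (SIGMA m:{3..}. coeff_index q s m)" "\<kappa> \<noteq> \<nu>" for \<kappa> \<nu>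
      using that by (cases \<kappa>; cases \<nu>) (metis coeff_event_pairwise_indep[OF q s] mem_Sigma_iff)
    show "\<not> (\<lambda>\<kappa>. prob (coeff_event q s \<kappa>)) summable_on (SIGMA m:{3..}. coeff_index q s m)"
      using q s by (rule coeff_event_not_summable)
  qed
qed

lemma star_discrepancy_ge_if_coeff_event:
  assumes q: "prime q" and s: "s \<ge> 1" and x: "x \<in> coeff_index q s m"
    and C: "C \<in> coeff_event q s (m, x)"
  shows "star_discrepancy s (digital_sequence q C) (q ^ (s * m + excess q s m)) \<ge> real q ^ excess q s m / 4"
proof -
  have q2: "q \<ge> 2" using q by (rule prime_ge_2_nat)
  obtain d k where dk: "x = (d, k)" "d \<in> compositions s (s * m)" "k \<in> monic_coeffs q s d"
    using x by (auto simp: coeff_index_def)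
  have d: "(\<Sum>j<s. d j) = s * m" "d 0 \<ge> 1" using dk(2) s by (auto simp: compositions_def PiE_iff)
  have "C \<in> vanishing q s (s * m + excess q s m) k" using C by (simp add: coeff_event_def dk(1))
  from star_discrepancy_ge_if_vanishing[OF q2 s this monic_coeffs_support[OF dk(3)] d(2)]
  show ?thesis using monic_coeffs_lead[OF dk(3), of 0] s d q2 by (simp add: power_add)
qed

theorem theorem2:
  fixes s q :: nat
  assumes "s \<ge> 1" and "prime q"
  shows "\<exists>c::real. c > 0 \<and>
    (AE C in matrix_tuple_measure q s.
       infinite {N. N \<ge> 1 \<and>
         star_discrepancy s (digital_sequence q C) N \<ge> c * ln (real N) ^ s * ln (ln (real N))})"
proof -
  have q2: "q \<ge> 2" using assms(2) by (rule prime_ge_2_nat)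
  define K where "K = (real s + 1) * (ln (real q) + 1)"
  have "ln (real q) > 0" using q2 by simp
  then have K: "K \<ge> 1" unfolding K_def using mult_mono[of 1 "real s + 1" 1 "ln (real q) + 1"] by simp
  define B where "B = K ^ s * (1 + ln K)"
  have B: "B > 0" unfolding B_def using K by (intro mult_pos_pos add_pos_nonneg) auto
  \<comment> \<open>\<open>B\<close> compares the target order with q^excess, and the 4 is the loss
    in the discrepancy bound for a single event.\<close>
  define c where "c = 1 / (4 * B)"
  define L where "L m = s * m + excess q s m" for m
  have large: "star_discrepancy s (digital_sequence q C) (q ^ L m)
      \<ge> c * ln (real (q ^ L m)) ^ s * ln (ln (real (q ^ L m)))"
    if "m \<ge> 3" "x \<in> coeff_index q s m" "C \<in> coeff_event q s (m, x)" for C m x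
  proof -
    have "c * ln (real (q ^ L m)) ^ s * ln (ln (real (q ^ L m))) = c * (ln (real (q ^ L m)) ^ s * ln (ln (real (q ^ L m))))"
      by (rule mult.assoc)
    also have "\<dots> \<le> c * (B * real q ^ excess q s m)"
      using discrepancy_scale_le[OF q2 that(1), of s] B unfolding B_def K_def L_def c_def
      by (intro mult_left_mono) auto
    also have "\<dots> = real q ^ excess q s m / 4" using B by (simp add: c_def)
    also have "\<dots> \<le> star_discrepancy s (digital_sequence q C) (q ^ L m)"
      unfolding L_def by (rule star_discrepancy_ge_if_coeff_event[OF assms(2,1) that(2,3)])
    finally show ?thesis .
  qed
  have "AE C in matrix_tuple_measure q s.
       infinite {N. N \<ge> 1 \<and>
         star_discrepancy s (digital_sequence q C) N \<ge> c * ln (real N) ^ s * ln (ln (real N))}"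
    using AE_infinite_coeff_events[OF assms(2,1)]
  proof eventually_elim
    case (elim C)
    show ?case
    proof
      assume "finite {N. N \<ge> 1 \<and>
         star_discrepancy s (digital_sequence q C) N \<ge> c * ln (real N) ^ s * ln (ln (real N))}" (is "finite ?T")
      then obtain b where b: "\<And>N. N \<in> ?T \<Longrightarrow> N \<le> b" by (meson finite_nat_set_iff_bounded_le)
      \<comment> \<open>Many indices share one level \<open>m\<close> and hence one N, so infinitely
        many events do not give infinitely many N at once. But each level has finitely many indices
        and m \<le> L m < q^(L m), so a bound on N bounds \<open>m\<close> and leaves only finitely
        many indices.\<close>
      have "{\<kappa> \<in> (SIGMA m:{3..}. coeff_index q s m). C \<in> coeff_event q s \<kappa>} \<subseteq> (SIGMA m:{..b}. coeff_index q s m)"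
      proof
        fix \<kappa> assume \<kappa>: "\<kappa> \<in> {\<kappa> \<in> (SIGMA m:{3..}. coeff_index q s m). C \<in> coeff_event q s \<kappa>}"
        obtain m x where mx: "\<kappa> = (m, x)" by (cases \<kappa>)
        then have h: "3 \<le> m" "x \<in> coeff_index q s m" "C \<in> coeff_event q s (m, x)" using \<kappa> by auto
        have "q ^ L m \<in> ?T" using large[OF h] q2 by simp
        then have "q ^ L m \<le> b" by (rule b)
        moreover have "m \<le> L m" using assms(1) by (simp add: L_def trans_le_add1)
        moreover have "L m < q ^ L m" using q2 by (intro power_gt_expt) auto
        ultimately show "\<kappa> \<in> (SIGMA m:{..b}. coeff_index q s m)" using h(2) mx by simp
      qed
      then have "finite {\<kappa> \<in> (SIGMA m:{3..}. coeff_index q s m). C \<in> coeff_event q s \<kappa>}"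
        by (rule finite_subset) (auto simp: finite_coeff_index)
      with elim show False by simp
    qed
  qed
  moreover have "c > 0" using B by (simp add: c_def)
  ultimately show ?thesis by blast
qed

end
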